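(* Let $G$ be a polycyclic-by-finite group and let $S=\bigoplus_{g\in G}S_g$ be an epsilon-strongly $G$-graded ring with principal component $R=S_e$. If $R$ is right (respectively left) noetherian, then $S$ is right (respectively left) noetherian.
   Context: All rings are associative with multiplicative identity $1\neq 0$. A ring $S$ is $G$-graded if $S=\bigoplus_{g\in G}S_g$ for additive subgroups $S_g$ with $S_gS_h\subseteq S_{gh}$ for all $g,h\in G$; $S_e$ is the principal component. $S$ is epsilon-strongly $G$-graded if (a) $S_gS_{g^{-1}}S_g=S_g$ for all $g\in G$, and (b) for each $g\in G$ the ideal $S_gS_{g^{-1}}$ of $S_e$ has a multiplicative identity. A group is polycyclic-by-finite if it has a subnormal series $1=G_0\lhd G_1\lhd\cdots\lhd G_n\lhd G_{n+1}=G$ with $G/G_n$ finite and each $G_{i+1}/G_i$ ($0\le i\le n-1$) cyclic. *)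

theory Defs
  imports "HOL-Algebra.Algebra"
begin

definition polycyclic_by_finite :: "('g, 'c) monoid_scheme \<Rightarrow> bool" where
  "polycyclic_by_finite G \<longleftrightarrow>
     (\<exists>(n::nat) (H :: nat \<Rightarrow> 'g set).
        H 0 = {\<one>\<^bsub>G\<^esub>} \<and> H (Suc n) = carrier G \<and>
        (\<forall>i\<le>n. subgroup (H (Suc i)) G \<and> normal (H i) (G\<lparr>carrier := H (Suc i)\<rparr>)) \<and>
        finite (carrier (G Mod (H n))) \<and>
        (\<forall>i<n. cyclic_group ((G\<lparr>carrier := H (Suc i)\<rparr>) Mod (H i))))"

inductive_set ring_set_prod :: "('a, 'b) ring_scheme \<Rightarrow> 'a set \<Rightarrow> 'a set \<Rightarrow> 'a set"
  for S :: "('a, 'b) ring_scheme" and A B :: "'a set" where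
  zero: "\<zero>\<^bsub>S\<^esub> \<in> ring_set_prod S A B"
| step: "a \<in> A \<Longrightarrow> b \<in> B \<Longrightarrow> x \<in> ring_set_prod S A B \<Longrightarrow>
         (a \<otimes>\<^bsub>S\<^esub> b) \<oplus>\<^bsub>S\<^esub> x \<in> ring_set_prod S A B"

definition graded_ring ::
  "('g, 'c) monoid_scheme \<Rightarrow> ('a, 'b) ring_scheme \<Rightarrow> ('g \<Rightarrow> 'a set) \<Rightarrow> bool" where
  "graded_ring G S Sg \<longleftrightarrow>
     (\<forall>g\<in>carrier G. subgroup (Sg g) (add_monoid S)) \<and>
     (\<forall>x\<in>carrier S. \<exists>!f. (\<forall>g\<in>carrier G. f g \<in> Sg g) \<and> (\<forall>g. g \<notin> carrier G \<longrightarrow> f g = \<zero>\<^bsub>S\<^esub>) \<and>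
          finite {g. f g \<noteq> \<zero>\<^bsub>S\<^esub>} \<and> x = finsum S f {g. f g \<noteq> \<zero>\<^bsub>S\<^esub>}) \<and>
     (\<forall>g\<in>carrier G. \<forall>h\<in>carrier G. \<forall>x\<in>Sg g. \<forall>y\<in>Sg h. x \<otimes>\<^bsub>S\<^esub> y \<in> Sg (g \<otimes>\<^bsub>G\<^esub> h))"

definition epsilon_strongly_graded ::
  "('g, 'c) monoid_scheme \<Rightarrow> ('a, 'b) ring_scheme \<Rightarrow> ('g \<Rightarrow> 'a set) \<Rightarrow> bool" where
  "epsilon_strongly_graded G S Sg \<longleftrightarrow>
     graded_ring G S Sg \<and>
     (\<forall>g\<in>carrier G.
        ring_set_prod S (ring_set_prod S (Sg g) (Sg (inv\<^bsub>G\<^esub> g))) (Sg g) = Sg g) \<and>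
     (\<forall>g\<in>carrier G. \<exists>e\<in>ring_set_prod S (Sg g) (Sg (inv\<^bsub>G\<^esub> g)).
        \<forall>x\<in>ring_set_prod S (Sg g) (Sg (inv\<^bsub>G\<^esub> g)). e \<otimes>\<^bsub>S\<^esub> x = x \<and> x \<otimes>\<^bsub>S\<^esub> e = x)"

definition right_ideal_in :: "('a, 'b) ring_scheme \<Rightarrow> 'a set \<Rightarrow> 'a set \<Rightarrow> bool" where
  "right_ideal_in S R I \<longleftrightarrow> I \<subseteq> R \<and> subgroup I (add_monoid S) \<and>
     (\<forall>x\<in>I. \<forall>r\<in>R. x \<otimes>\<^bsub>S\<^esub> r \<in> I)"

definition left_ideal_in :: "('a, 'b) ring_scheme \<Rightarrow> 'a set \<Rightarrow> 'a set \<Rightarrow> bool" where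
  "left_ideal_in S R I \<longleftrightarrow> I \<subseteq> R \<and> subgroup I (add_monoid S) \<and>
     (\<forall>x\<in>I. \<forall>r\<in>R. r \<otimes>\<^bsub>S\<^esub> x \<in> I)"

definition right_noetherian_on :: "('a, 'b) ring_scheme \<Rightarrow> 'a set \<Rightarrow> bool" where
  "right_noetherian_on S R \<longleftrightarrow>
     (\<forall>I :: nat \<Rightarrow> 'a set. (\<forall>n. right_ideal_in S R (I n)) \<and> (\<forall>n. I n \<subseteq> I (Suc n)) \<longrightarrow>
        (\<exists>N. \<forall>n\<ge>N. I n = I N))"

definition left_noetherian_on :: "('a, 'b) ring_scheme \<Rightarrow> 'a set \<Rightarrow> bool" where
  "left_noetherian_on S R \<longleftrightarrow>
     (\<forall>I :: nat \<Rightarrow> 'a set. (\<forall>n. left_ideal_in S R (I n)) \<and> (\<forall>n. I n \<subseteq> I (Suc n)) \<longrightarrow>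
        (\<exists>N. \<forall>n\<ge>N. I n = I N))"

end

theory Submission
  imports Defs
begin

text \<open>
  For a subset \<open>A\<close> of the group let \<open>S\<^sub>A\<close> be the sum of the components with degree in \<open>A\<close>.
  One climbs the subnormal series, showing that \<open>S\<^sub>H\<close> is right noetherian for each term \<open>H\<close>.

  Local units of components are combined by \<open>e \<or> f = e + f - ef\<close>. As the principal component is
  noetherian this process stops, so every \<open>A\<close> has a unit \<open>e\<close> in the product of
  \<open>S\<^sub>A\<close> and \<open>S\<^sub>B\<close>, \<open>B = A\<^sup>-\<^sup>1\<close>, which fixes \<open>S\<^sub>A\<close> from the left and \<open>S\<^sub>B\<close> from the right.
  Writing \<open>e\<close> as a finite sum of products \<open>ab\<close> shows that \<open>S\<^sub>C\<close> is a finitely generated right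
  \<open>S\<^sub>H\<close>-module for each coset \<open>C\<close> of \<open>H\<close>; this settles the finite quotient.

  For a cyclic quotient write \<open>T\<^sub>n\<close> for the sum over the coset \<open>H k\<^sup>n\<close>. To a right ideal \<open>I\<close>
  attach the right ideals \<open>L\<^sub>l\<close> of \<open>T\<^sub>0\<close> that consist of the degree \<open>0\<close> terms of the elements of
  \<open>I\<close> supported in degrees \<open>-l, \<dots>, 0\<close>. They increase with \<open>l\<close> and with \<open>I\<close>. If \<open>I\<close> is contained in
  \<open>J\<close> and both have the same \<open>L\<^sub>l\<close>, then \<open>I = J\<close>, by induction on the length of the support of an
  element \<open>x\<close> of \<open>J\<close>: if \<open>b\<close> is its top degree and \<open>e\<close> the right unit of \<open>T\<^sub>b\<close>, then \<open>x - xe\<close> has a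
  shorter support, while \<open>xe\<close> is a combination of elements of \<open>J\<close> with top degree \<open>0\<close>.
  Nowhere does this use that the sums are direct, so finite cyclic quotients need no separate treatment.

  The left-hand statement is the right-hand one for the opposite ring, graded by
  \<open>g \<mapsto> S\<close> in degree \<open>g\<^sup>-\<^sup>1\<close>.
\<close>

section \<open>Additive spans and their products\<close>

definition add_span :: "('a, 'b) ring_scheme \<Rightarrow> 'a set \<Rightarrow> 'a set" where
  "add_span S Z = generate (add_monoid S) Z"

text \<open>Closed under negation by construction, whatever the factors, whereas
  \<open>ring_set_prod\<close> only collects sums of products. The two agree once the left factor is
  an additive subgroup and the right one lies in the ring.\<close>

definition span_prod :: "('a, 'b) ring_scheme \<Rightarrow> 'a set \<Rightarrow> 'a set \<Rightarrow> 'a set" where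
  "span_prod S A B = add_span S {a \<otimes>\<^bsub>S\<^esub> b | a b. a \<in> A \<and> b \<in> B}"

context ring
begin

lemma diff_add_add_cancel:
  "a \<in> carrier R \<Longrightarrow> b \<in> carrier R \<Longrightarrow> c \<in> carrier R \<Longrightarrow> (a \<oplus> \<ominus> b) \<oplus> (c \<oplus> b) = a \<oplus> c"
  by (simp add: a_assoc a_comm[of c b] r_neg1)

lemma add_diff_add_cancel:
  "a \<in> carrier R \<Longrightarrow> b \<in> carrier R \<Longrightarrow> c \<in> carrier R \<Longrightarrow> (a \<oplus> c) \<oplus> \<ominus> (c \<oplus> b) = a \<oplus> \<ominus> b"
  by (simp add: minus_add a_assoc r_neg2)

lemma add_span_zero: "\<zero> \<in> add_span R Z"
  using generate.one[of "add_monoid R" Z] by (simp add: add_span_def)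

lemma add_span_incl: "x \<in> Z \<Longrightarrow> x \<in> add_span R Z"
  unfolding add_span_def by (rule generate.incl)

lemma add_span_add: "x \<in> add_span R Z \<Longrightarrow> y \<in> add_span R Z \<Longrightarrow> x \<oplus> y \<in> add_span R Z"
  using generate.eng[of x "add_monoid R" Z y] by (simp add: add_span_def)

lemma add_span_induct [consumes 1, case_names zero incl uminus add]:
  assumes "x \<in> add_span R Z"
    and "P \<zero>"
    and "\<And>h. h \<in> Z \<Longrightarrow> P h"
    and "\<And>h. h \<in> Z \<Longrightarrow> P (\<ominus> h)"
    and "\<And>x y. x \<in> add_span R Z \<Longrightarrow> P x \<Longrightarrow> y \<in> add_span R Z \<Longrightarrow> P y \<Longrightarrow> P (x \<oplus> y)"
  shows "P x"
  using assms(1) unfolding add_span_def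
  by (induction rule: generate.induct)
    (use assms in \<open>simp_all add: add_span_def a_inv_def\<close>)

lemma add_span_subgroup: "Z \<subseteq> carrier R \<Longrightarrow> additive_subgroup (add_span R Z) R"
  using add.generate_is_subgroup[of Z] by (simp add: add_span_def additive_subgroup_def)

lemma add_span_carrier: "Z \<subseteq> carrier R \<Longrightarrow> x \<in> add_span R Z \<Longrightarrow> x \<in> carrier R"
  using additive_subgroup.a_subset[OF add_span_subgroup] by blast

lemma add_span_mono: "Z \<subseteq> Y \<Longrightarrow> add_span R Z \<subseteq> add_span R Y"
  unfolding add_span_def by (rule add.mono_generate)

lemma add_span_least: "additive_subgroup A R \<Longrightarrow> Z \<subseteq> A \<Longrightarrow> add_span R Z \<subseteq> A"
  unfolding add_span_def additive_subgroup_def by (rule add.generate_subgroup_incl)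

lemma add_span_of_subgroup: "additive_subgroup A R \<Longrightarrow> add_span R A = A"
  using add_span_least[of A A] add_span_incl by blast

text \<open>Sums \<open>y \<oplus> z\<close> of this kind are closed under addition by commutativity
  and cover both sets of generators. The splitting need not be unique; it separates the last
  generator, or the top component, from the rest.\<close>

lemma add_span_Un_decomp:
  assumes "Z \<subseteq> carrier R" "additive_subgroup B R" "x \<in> add_span R (Z \<union> B)"
  shows "\<exists>y\<in>add_span R Z. \<exists>z\<in>B. x = y \<oplus> z"
proof -
  interpret B: additive_subgroup B R by fact
  interpret Z: additive_subgroup "add_span R Z" R by (rule add_span_subgroup) fact
  have summand: "\<exists>y\<in>add_span R Z. \<exists>z\<in>B. h = y \<oplus> z" if "h \<in> add_span R Z \<or> h \<in> B" for h
    using that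
  proof
    assume "h \<in> add_span R Z"
    then show ?thesis
      by (intro bexI[of _ h] bexI[of _ \<zero>]) simp_all
  next
    assume "h \<in> B"
    then show ?thesis
      by (intro bexI[of _ \<zero>] bexI[of _ h]) simp_all
  qed
  show ?thesis
    using assms(3)
  proof (induction rule: add_span_induct)
    case zero
    show ?case by (rule summand) simp
  next
    case (incl h)
    then show ?case using add_span_incl by (intro summand) auto
  next
    case (uminus h)
    then show ?case using add_span_incl by (intro summand) auto
  next
    case (add x x')
    then obtain y z y' z' where
      "y \<in> add_span R Z" "z \<in> B" "x = y \<oplus> z" "y' \<in> add_span R Z" "z' \<in> B" "x' = y' \<oplus> z'"
      by blast
    moreover from this have "x \<oplus> x' = (y \<oplus> y') \<oplus> (z \<oplus> z')"
      using Z.a_Hcarr B.a_Hcarr by (simp add: a_ac)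
    ultimately show ?case by (intro bexI[of _ "y \<oplus> y'"] bexI[of _ "z \<oplus> z'"]) simp_all
  qed
qed

text \<open>By biadditivity, membership of a product only has to be checked on generators. The inner
  induction runs over \<open>y\<close> with a generator on the left, the outer one over
  \<open>x\<close>.\<close>

lemma add_span_mult:
  assumes Z: "Z \<subseteq> carrier R" and Y: "Y \<subseteq> carrier R" and C: "additive_subgroup C R"
    and ZY: "\<And>x y. x \<in> Z \<Longrightarrow> y \<in> Y \<Longrightarrow> x \<otimes> y \<in> C"
    and x: "x \<in> add_span R Z" and y: "y \<in> add_span R Y"
  shows "x \<otimes> y \<in> C"
proof -
  interpret C: additive_subgroup C R by fact
  have *: "h \<otimes> y \<in> C" if h: "h \<in> Z" for h
  proof -
    have hc: "h \<in> carrier R" using h Z by auto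
    show ?thesis
      using y
    proof (induction rule: add_span_induct)
      case (uminus k)
      then show ?case using ZY[OF h] Y hc by (metis C.a_inv_closed r_minus subsetD)
    next
      case (add a b)
      then show ?case using add_span_carrier[OF Y] hc by (simp add: r_distr)
    qed (use ZY h hc in auto)
  qed
  have yc: "y \<in> carrier R" using y add_span_carrier[OF Y] by blast
  show ?thesis
    using x
  proof (induction rule: add_span_induct)
    case (uminus k)
    then show ?case using * Z yc by (metis C.a_inv_closed l_minus subsetD)
  next
    case (add a b)
    then show ?case using add_span_carrier[OF Z] yc by (simp add: l_distr)
  qed (use * yc in auto)
qed

lemma span_prod_gens_carrier:
  "A \<subseteq> carrier R \<Longrightarrow> B \<subseteq> carrier R \<Longrightarrow> {a \<otimes> b | a b. a \<in> A \<and> b \<in> B} \<subseteq> carrier R"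
  by auto

lemma span_prod_subgroup:
  "A \<subseteq> carrier R \<Longrightarrow> B \<subseteq> carrier R \<Longrightarrow> additive_subgroup (span_prod R A B) R"
  unfolding span_prod_def by (rule add_span_subgroup[OF span_prod_gens_carrier])

lemma span_prod_carrier:
  "A \<subseteq> carrier R \<Longrightarrow> B \<subseteq> carrier R \<Longrightarrow> x \<in> span_prod R A B \<Longrightarrow> x \<in> carrier R"
  using additive_subgroup.a_subset[OF span_prod_subgroup] by blast

lemma span_prod_incl: "a \<in> A \<Longrightarrow> b \<in> B \<Longrightarrow> a \<otimes> b \<in> span_prod R A B"
  unfolding span_prod_def by (rule add_span_incl) auto

lemma span_prod_mono: "A \<subseteq> A' \<Longrightarrow> B \<subseteq> B' \<Longrightarrow> span_prod R A B \<subseteq> span_prod R A' B'"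
  unfolding span_prod_def by (rule add_span_mono) auto

lemma span_prod_least:
  assumes "additive_subgroup C R" "\<And>a b. a \<in> A \<Longrightarrow> b \<in> B \<Longrightarrow> a \<otimes> b \<in> C"
  shows "span_prod R A B \<subseteq> C"
  unfolding span_prod_def by (rule add_span_least) (use assms in auto)

lemma ring_set_prod_subset_span_prod: "ring_set_prod R A B \<subseteq> span_prod R A B"
proof
  fix x assume "x \<in> ring_set_prod R A B"
  then show "x \<in> span_prod R A B"
    by induction (auto simp: span_prod_def intro: add_span_zero add_span_add add_span_incl)
qed

lemma span_prod_mult_right:
  assumes "A \<subseteq> carrier R" "B \<subseteq> carrier R" "r \<in> carrier R"
    and "\<And>b. b \<in> B \<Longrightarrow> b \<otimes> r \<in> B" and x: "x \<in> span_prod R A B"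
  shows "x \<otimes> r \<in> span_prod R A B"
proof (rule add_span_mult[OF span_prod_gens_carrier _ span_prod_subgroup])
  show "x \<in> add_span R {a \<otimes> b |a b. a \<in> A \<and> b \<in> B}" using x by (simp add: span_prod_def)
  \<comment> \<open>The single element is treated as a member of a span, so that biadditivity
    reduces the claim to products \<open>a \<otimes> b\<close>.\<close>
  show "r \<in> add_span R {r}" by (rule add_span_incl) simp
  fix p q assume "p \<in> {a \<otimes> b |a b. a \<in> A \<and> b \<in> B}" "q \<in> {r}"
  then obtain a b where "a \<in> A" "b \<in> B" "p = a \<otimes> b" "q = r" by auto
  then show "p \<otimes> q \<in> span_prod R A B"
    using assms span_prod_incl[of a A "b \<otimes> r" B] by (simp add: m_assoc subsetD)
qed (use assms in auto)

text \<open>The elements that \<open>e\<close> fixes from the left form an additive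
  subgroup.\<close>

lemma span_left_unit:
  assumes Z: "Z \<subseteq> carrier R" and e: "e \<in> carrier R" and u: "\<And>x. x \<in> Z \<Longrightarrow> e \<otimes> x = x"
    and s: "s \<in> add_span R Z"
  shows "e \<otimes> s = s"
  using s
proof (induction rule: add_span_induct)
  case (uminus h) then show ?case using Z u e by (metis r_minus subsetD)
next
  case (add x y) then show ?case using e add_span_carrier[OF Z] by (simp add: r_distr)
qed (use e u in auto)

lemma span_right_unit:
  assumes Z: "Z \<subseteq> carrier R" and e: "e \<in> carrier R" and u: "\<And>x. x \<in> Z \<Longrightarrow> x \<otimes> e = x"
    and s: "s \<in> add_span R Z"
  shows "s \<otimes> e = s"
  using s
proof (induction rule: add_span_induct)
  case (uminus h) then show ?case using Z u e by (metis l_minus subsetD)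
next
  case (add x y) then show ?case using e add_span_carrier[OF Z] by (simp add: l_distr)
qed (use e u in auto)

lemma span_prod_left_unit:
  assumes "A \<subseteq> carrier R" "B \<subseteq> carrier R" "e \<in> carrier R" "\<And>a. a \<in> A \<Longrightarrow> e \<otimes> a = a"
    and "x \<in> span_prod R A B"
  shows "e \<otimes> x = x"
  by (rule span_left_unit[OF span_prod_gens_carrier[OF assms(1,2)] assms(3) _ assms(5)[unfolded span_prod_def]])
    (use assms in \<open>auto simp: m_assoc[symmetric] subsetD\<close>)

lemma span_prod_right_unit:
  assumes "A \<subseteq> carrier R" "B \<subseteq> carrier R" "e \<in> carrier R" "\<And>b. b \<in> B \<Longrightarrow> b \<otimes> e = b"
    and "x \<in> span_prod R A B"
  shows "x \<otimes> e = x"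
  by (rule span_right_unit[OF span_prod_gens_carrier[OF assms(1,2)] assms(3) _ assms(5)[unfolded span_prod_def]])
    (use assms in \<open>auto simp: m_assoc subsetD\<close>)

lemma finsum_in_additive_subgroup:
  assumes "additive_subgroup A R" "finite F" "\<And>i. i \<in> F \<Longrightarrow> f i \<in> A"
  shows "finsum R f F \<in> A"
proof -
  interpret A: additive_subgroup A R by fact
  show ?thesis
    using assms(2,3)
  proof (induction F rule: finite_induct)
    case (insert i F)
    then have "f \<in> F \<rightarrow> carrier R" "f i \<in> carrier R" by auto
    then show ?case using insert by (simp add: finsum_insert)
  qed simp
qed

text \<open>When the left factor is closed under negation, \<open>\<ominus> (a \<otimes> b)\<close>
  is the product \<open>(\<ominus> a) \<otimes> b\<close>, so sums of products already contain the
  negatives.\<close>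

lemma ring_set_prod_eq_span_prod:
  assumes A: "additive_subgroup A R" and B: "B \<subseteq> carrier R"
  shows "ring_set_prod R A B = span_prod R A B"
proof
  interpret A: additive_subgroup A R by fact
  have carr: "x \<in> carrier R" if "x \<in> ring_set_prod R A B" for x
    using that ring_set_prod_subset_span_prod span_prod_carrier[OF A.a_subset B] by blast
  have add: "x \<oplus> y \<in> ring_set_prod R A B" if "x \<in> ring_set_prod R A B" "y \<in> ring_set_prod R A B" for x y
    using that(1)
  proof (induction rule: ring_set_prod.induct)
    case zero
    then show ?case using that(2) carr by simp
  next
    case (step a b x)
    then have "a \<otimes> b \<oplus> x \<oplus> y = a \<otimes> b \<oplus> (x \<oplus> y)"
      using carr that(2) B by (simp add: a_assoc subsetD)
    then show ?case using step ring_set_prod.step by metis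
  qed
  have prod: "a \<otimes> b \<in> ring_set_prod R A B" if "a \<in> A" "b \<in> B" for a b
    using ring_set_prod.step[OF that ring_set_prod.zero[of R]] that B by (simp add: subsetD)
  show "span_prod R A B \<subseteq> ring_set_prod R A B"
  proof
    fix x assume "x \<in> span_prod R A B"
    then show "x \<in> ring_set_prod R A B"
      unfolding span_prod_def
    proof (induction rule: add_span_induct)
      case (uminus h)
      then obtain a b where "a \<in> A" "b \<in> B" "h = a \<otimes> b" by blast
      then show ?case using prod[of "\<ominus> a" b] B by (simp add: l_minus subsetD)
    qed (use add prod in \<open>auto intro: ring_set_prod.zero\<close>)
  qed
qed (rule ring_set_prod_subset_span_prod)

text \<open>Serves to rebracket the product of the components at the inverse of \<open>g\<close>, at
  \<open>g\<close> and at the inverse of \<open>g\<close>, so that the ideal belonging to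
  \<open>g\<close> stands on the right.\<close>

lemma span_prod_assoc:
  assumes A: "A \<subseteq> carrier R" and B: "B \<subseteq> carrier R" and C: "C \<subseteq> carrier R"
  shows "span_prod R (span_prod R A B) C \<subseteq> span_prod R A (span_prod R B C)"
proof -
  have BC: "span_prod R B C \<subseteq> carrier R" using span_prod_carrier[OF B C] by blast
  note P = span_prod_subgroup[OF A BC]
  show ?thesis
  proof (rule span_prod_least[OF P])
    fix p c assume p: "p \<in> span_prod R A B" and c: "c \<in> C"
    show "p \<otimes> c \<in> span_prod R A (span_prod R B C)"
    proof (rule add_span_mult[OF span_prod_gens_carrier[OF A B] C P])
      fix x y assume "x \<in> {a \<otimes> b |a b. a \<in> A \<and> b \<in> B}" "y \<in> C"
      then obtain a b where "a \<in> A" "b \<in> B" "x = a \<otimes> b" by blast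
      then show "x \<otimes> y \<in> span_prod R A (span_prod R B C)"
        using A B C \<open>y \<in> C\<close> span_prod_incl[of a A "b \<otimes> y" "span_prod R B C"] span_prod_incl[of b B y C]
        by (simp add: m_assoc subsetD)
    qed (use p c in \<open>simp_all add: span_prod_def add_span_incl\<close>)
  qed
qed

end

section \<open>Ascending chains\<close>

lemma right_noetherianD:
  assumes "right_noetherian_on S T" "\<And>n. right_ideal_in S T (I n)" "\<And>n. I n \<subseteq> I (Suc n)"
  obtains N where "\<And>n. n \<ge> N \<Longrightarrow> I n = I N"
proof -
  have "\<exists>N. \<forall>n\<ge>N. I n = I N"
    using assms by (simp add: right_noetherian_on_def)
  then show ?thesis using that by blast
qed

text \<open>Otherwise a choice of strictly larger members, iterated from some \<open>M0\<close>,
  would produce a strictly increasing chain.\<close>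

lemma right_noetherian_maximal:
  assumes noeth: "right_noetherian_on S T" and ne: "A \<noteq> {}"
    and ideals: "\<And>I. I \<in> A \<Longrightarrow> right_ideal_in S T I"
  shows "\<exists>M\<in>A. \<forall>I\<in>A. M \<subseteq> I \<longrightarrow> I = M"
proof (rule ccontr)
  assume "\<not> ?thesis"
  then have "\<forall>M\<in>A. \<exists>I\<in>A. M \<subset> I" by blast
  then obtain f where f: "\<And>M. M \<in> A \<Longrightarrow> f M \<in> A \<and> M \<subset> f M" by metis
  obtain M0 where M0: "M0 \<in> A" using ne by blast
  define J where "J n = (f ^^ n) M0" for n
  have JA: "J n \<in> A" for n
    using M0 f by (induction n) (simp_all add: J_def)
  have Jlt: "J n \<subset> J (Suc n)" for n
    using f[OF JA[of n]] by (simp add: J_def)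
  obtain N where N: "\<And>n. n \<ge> N \<Longrightarrow> J n = J N"
  proof (rule right_noetherianD[OF noeth, of J])
    show "right_ideal_in S T (J n)" "J n \<subseteq> J (Suc n)" for n
      using ideals[OF JA] Jlt[of n] by auto
  qed blast
  show False
    using Jlt[of N] N[of "Suc N"] by simp
qed

text \<open>The point is an index that is uniform in the row \<open>l\<close>. The diagonal stops at
  some \<open>M\<close>; an entry with both indices at least \<open>M\<close> lies between
  \<open>L M M\<close> and a later diagonal entry, hence equals \<open>L M M\<close>. The finitely
  many rows below \<open>M\<close> stop separately.\<close>

lemma right_noetherian_double_chain:
  assumes noeth: "right_noetherian_on S T"
    and ideals: "\<And>l k. right_ideal_in S T (L l k)"
    and mono: "\<And>l l' k k'. l \<le> l' \<Longrightarrow> k \<le> k' \<Longrightarrow> L l k \<subseteq> L l' k'"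
  shows "\<exists>N::nat. \<forall>l::nat. \<forall>k\<ge>N. L l k = L l N"
proof -
  obtain M where M: "\<And>n. n \<ge> M \<Longrightarrow> L n n = L M M"
    by (rule right_noetherianD[OF noeth, of "\<lambda>n. L n n"]) (use ideals mono in auto)
  have "\<exists>n. \<forall>k\<ge>n. L l k = L l n" for l
    by (rule right_noetherianD[OF noeth, of "L l"]) (use ideals mono in auto)
  then obtain n where n: "\<And>l k. k \<ge> n l \<Longrightarrow> L l k = L l (n l)" by metis
  \<comment> \<open>Inserting \<open>M\<close> covers the rows from \<open>M\<close> on and keeps
    the set nonempty for \<open>Max\<close>.\<close>
  define N where "N = Max (insert M (n ` {..<M}))"
  have NM: "M \<le> N" and Nn: "l < M \<Longrightarrow> n l \<le> N" for l
    by (auto simp: N_def)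
  have "L l k = L l N" if k: "k \<ge> N" for l k
  proof (cases "l < M")
    case True
    then show ?thesis using n[of l k] n[of l N] Nn[of l] k by simp
  next
    case False
    have "L l k' = L M M" if "k' \<ge> M" for k'
      using mono[of M l M k'] mono[of l "max l k'" k' "max l k'"] M[of "max l k'"] that False by auto
    then show ?thesis using NM k by simp
  qed
  then show ?thesis by blast
qed

section \<open>Chains of submodules of finitely generated modules\<close>

context ring
begin

definition right_submodule :: "'a set \<Rightarrow> 'a set \<Rightarrow> bool" where
  "right_submodule T I \<longleftrightarrow> additive_subgroup I R \<and> (\<forall>x\<in>I. \<forall>t\<in>T. x \<otimes> t \<in> I)"

lemma right_submodule_Int:
  assumes "right_submodule T I" "right_submodule T J"
  shows "right_submodule T (I \<inter> J)"
  using assms add.subgroups_Inter_pair[of I J]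
  by (auto simp: right_submodule_def additive_subgroup_def)

lemma span_prod_submodule:
  assumes F: "F \<subseteq> carrier R" and T: "T \<subseteq> carrier R" and TT: "\<And>s t. s \<in> T \<Longrightarrow> t \<in> T \<Longrightarrow> s \<otimes> t \<in> T"
  shows "right_submodule T (span_prod R F T)"
  unfolding right_submodule_def
  using span_prod_subgroup[OF F T] span_prod_mult_right[OF F T] T TT by blast

lemma left_translate_subgroup:
  assumes "additive_subgroup T R" "a \<in> carrier R"
  shows "additive_subgroup {a \<otimes> t | t. t \<in> T} R"
proof -
  interpret T: additive_subgroup T R by fact
  show ?thesis
  proof (intro additive_subgroupI add.subgroupI)
    show "{a \<otimes> t | t. t \<in> T} \<subseteq> carrier R" using assms(2) by auto
    show "{a \<otimes> t | t. t \<in> T} \<noteq> {}" using T.zero_closed by blast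
  next
    fix x assume "x \<in> {a \<otimes> t | t. t \<in> T}"
    then obtain t where "t \<in> T" "x = a \<otimes> t" by auto
    then show "\<ominus> x \<in> {a \<otimes> t | t. t \<in> T}"
      using assms(2) by (auto simp: r_minus intro!: exI[of _ "\<ominus> t"])
  next
    fix x y assume "x \<in> {a \<otimes> t | t. t \<in> T}" "y \<in> {a \<otimes> t | t. t \<in> T}"
    then obtain t u where "t \<in> T" "x = a \<otimes> t" "u \<in> T" "y = a \<otimes> u" by auto
    then show "x \<oplus> y \<in> {a \<otimes> t | t. t \<in> T}"
      using assms(2) by (auto simp: r_distr intro!: exI[of _ "t \<oplus> u"])
  qed
qed

text \<open>Finitely generated modules over a right noetherian ring are noetherian, here by
  induction on the generators. A member of the chain is controlled by its part in the span of
  \<open>F\<close> together with the possible coefficients of the new generator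
  \<open>a\<close>.\<close>

lemma finitely_generated_chain_stabilizes:
  assumes T: "additive_subgroup T R" and TT: "\<And>s t. s \<in> T \<Longrightarrow> t \<in> T \<Longrightarrow> s \<otimes> t \<in> T"
    and noeth: "right_noetherian_on R T"
    and "finite F" "F \<subseteq> carrier R"
    and "\<And>n. right_submodule T (I n)" "\<And>n. I n \<subseteq> I (Suc n)" "\<And>n. I n \<subseteq> span_prod R F T"
  shows "\<exists>N::nat. \<forall>n\<ge>N. I n = I N"
  using assms(4-)
proof (induction F arbitrary: I rule: finite_induct)
  case empty
  have "I n = {\<zero>}" for n
  proof -
    interpret I: additive_subgroup "I n" R
      using empty.prems(2)[of n] by (simp add: right_submodule_def)
    have "span_prod R {} T \<subseteq> {\<zero>}"
      by (rule span_prod_least) (auto intro: additive_subgroupI add.triv_subgroup[simplified])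
    then show ?thesis using empty.prems(4)[of n] I.zero_closed by blast
  qed
  then show ?case by blast
next
  case (insert a F)
  interpret T: additive_subgroup T R by fact
  have ac: "a \<in> carrier R" and Fc: "F \<subseteq> carrier R" using insert.prems by auto
  let ?M = "span_prod R F T"
  have Msub: "right_submodule T ?M"
    using span_prod_submodule[OF Fc T.a_subset] TT by blast
  interpret M: additive_subgroup ?M R
    using Msub by (simp add: right_submodule_def)
  have Isub: "additive_subgroup (I n) R" for n
    using insert.prems(2)[of n] by (simp add: right_submodule_def)
  \<comment> \<open>The coefficients of \<open>a\<close> in elements of \<open>I n\<close>, taken
    modulo \<open>?M\<close>; they form a right ideal of \<open>T\<close>.\<close>
  define J where "J n = {t \<in> T. \<exists>m\<in>?M. a \<otimes> t \<oplus> m \<in> I n}" for n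
  have Jid: "right_ideal_in R T (J n)" for n
  proof -
    interpret I: additive_subgroup "I n" R by (rule Isub)
    have "additive_subgroup (J n) R"
    proof (intro additive_subgroupI add.subgroupI)
      show "J n \<subseteq> carrier R" using T.a_subset by (auto simp: J_def)
      have "\<zero> \<in> J n" using ac by (auto simp: J_def intro!: bexI[of _ \<zero>])
      then show "J n \<noteq> {}" by blast
    next
      fix x assume "x \<in> J n"
      then obtain m where x: "x \<in> T" "m \<in> ?M" "a \<otimes> x \<oplus> m \<in> I n" by (auto simp: J_def)
      then have "\<ominus> (a \<otimes> x \<oplus> m) \<in> I n" by blast
      moreover have "\<ominus> (a \<otimes> x \<oplus> m) = a \<otimes> (\<ominus> x) \<oplus> \<ominus> m"
        using x ac by (simp add: minus_add r_minus)
      ultimately show "\<ominus> x \<in> J n" using x by (auto simp: J_def intro!: bexI[of _ "\<ominus> m"])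
    next
      fix x y assume "x \<in> J n" "y \<in> J n"
      then obtain m m' where x: "x \<in> T" "m \<in> ?M" "a \<otimes> x \<oplus> m \<in> I n"
        and y: "y \<in> T" "m' \<in> ?M" "a \<otimes> y \<oplus> m' \<in> I n" by (auto simp: J_def)
      then have "(a \<otimes> x \<oplus> m) \<oplus> (a \<otimes> y \<oplus> m') \<in> I n" by blast
      moreover have "(a \<otimes> x \<oplus> m) \<oplus> (a \<otimes> y \<oplus> m') = a \<otimes> (x \<oplus> y) \<oplus> (m \<oplus> m')"
        using x y ac by (simp add: r_distr a_ac)
      ultimately show "x \<oplus> y \<in> J n" using x y by (auto simp: J_def intro!: bexI[of _ "m \<oplus> m'"])
    qed
    moreover have "x \<otimes> r \<in> J n" if xr: "x \<in> J n" "r \<in> T" for x r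
    proof -
      obtain m where x: "x \<in> T" "m \<in> ?M" "a \<otimes> x \<oplus> m \<in> I n" using xr by (auto simp: J_def)
      then have "(a \<otimes> x \<oplus> m) \<otimes> r \<in> I n" "m \<otimes> r \<in> ?M"
        using insert.prems(2)[of n] Msub xr by (auto simp: right_submodule_def)
      moreover have "(a \<otimes> x \<oplus> m) \<otimes> r = a \<otimes> (x \<otimes> r) \<oplus> m \<otimes> r"
        using x xr ac by (simp add: l_distr m_assoc)
      ultimately show ?thesis using x xr TT by (auto simp: J_def intro!: bexI[of _ "m \<otimes> r"])
    qed
    ultimately show ?thesis
      by (auto simp: right_ideal_in_def additive_subgroup_def J_def)
  qed
  obtain N1 where N1: "\<And>n. n \<ge> N1 \<Longrightarrow> J n = J N1"
  proof (rule right_noetherianD[OF noeth, of J])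
    show "J n \<subseteq> J (Suc n)" for n
      using insert.prems(3)[of n] by (auto simp: J_def)
  qed (use Jid in blast)+
  have "\<exists>N. \<forall>n\<ge>N. I n \<inter> ?M = I N \<inter> ?M"
  proof (rule insert.IH[OF Fc])
    show "right_submodule T (I n \<inter> ?M)" for n
      by (rule right_submodule_Int[OF insert.prems(2) Msub])
    show "I n \<inter> ?M \<subseteq> I (Suc n) \<inter> ?M" for n
      using insert.prems(3)[of n] by blast
  qed blast
  then obtain N2 where N2: "\<And>n. n \<ge> N2 \<Longrightarrow> I n \<inter> ?M = I N2 \<inter> ?M" by blast
  define N where "N = max N1 N2"
  have "I n = I N" if n: "n \<ge> N" for n
  proof
    have le: "I N \<subseteq> I n" by (rule lift_Suc_mono_le[of I, OF insert.prems(3) n])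
    then show "I N \<subseteq> I n" .
    interpret In: additive_subgroup "I n" R by (rule Isub)
    interpret IN: additive_subgroup "I N" R by (rule Isub)
    show "I n \<subseteq> I N"
    proof
      fix x assume x: "x \<in> I n"
      have "{b \<otimes> t | b t. b \<in> insert a F \<and> t \<in> T} = {b \<otimes> t | b t. b \<in> F \<and> t \<in> T} \<union> {a \<otimes> t | t. t \<in> T}"
        by auto
      then have "x \<in> add_span R ({b \<otimes> t | b t. b \<in> F \<and> t \<in> T} \<union> {a \<otimes> t | t. t \<in> T})"
        using x insert.prems(4)[of n] by (auto simp: span_prod_def)
      then obtain m t where mt: "m \<in> ?M" "t \<in> T" "x = m \<oplus> a \<otimes> t"
        using add_span_Un_decomp[OF span_prod_gens_carrier[OF Fc T.a_subset]
            left_translate_subgroup[OF T ac], of x] by (auto simp: span_prod_def)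
      then have "t \<in> J n" using x ac by (auto simp: J_def a_comm intro!: bexI[of _ m])
      then have "t \<in> J N" using N1[of n] N1[of N] n by (auto simp: N_def)
      then obtain m' where m': "m' \<in> ?M" "a \<otimes> t \<oplus> m' \<in> I N" by (auto simp: J_def)
      \<comment> \<open>\<open>x\<close> and the element just found in \<open>I N\<close> have the
        same \<open>a\<close>-term. Their difference lies in \<open>?M\<close>, where the chain has
        already stopped by the induction hypothesis.\<close>
      have eq: "m \<oplus> \<ominus> m' = x \<oplus> \<ominus> (a \<otimes> t \<oplus> m')"
        using mt m' ac by (simp add: add_diff_add_cancel)
      have "m \<oplus> \<ominus> m' \<in> I n \<inter> ?M"
        unfolding Int_iff using mt m' x le by (metis eq In.a_closed In.a_inv_closed M.a_closed M.a_inv_closed subsetD)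
      then have "m \<oplus> \<ominus> m' \<in> I N" using N2[of n] N2[of N] n by (auto simp: N_def)
      then have "(m \<oplus> \<ominus> m') \<oplus> (a \<otimes> t \<oplus> m') \<in> I N" using m' by blast
      moreover have "(m \<oplus> \<ominus> m') \<oplus> (a \<otimes> t \<oplus> m') = x"
        using mt m' ac by (simp add: diff_add_add_cancel)
      ultimately show "x \<in> I N" by simp
    qed
  qed
  then show ?case by blast
qed

text \<open>If \<open>e\<close> is a signed sum of products \<open>a \<otimes> b\<close>, then
  \<open>e \<otimes> s\<close> is the corresponding sum of
  \<open>a \<otimes> (b \<otimes> s)\<close>, with coefficients in \<open>T\<close>;
  \<open>F\<close> collects the finitely many \<open>a\<close>. When \<open>e\<close> fixes
  \<open>A\<close> from the left, this bounds \<open>A\<close> by a finitely generated module over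
  \<open>T\<close>.\<close>

lemma span_prod_finite_left:
  assumes A: "A \<subseteq> carrier R" and B: "B \<subseteq> carrier R" and T: "additive_subgroup T R"
    and BA: "\<And>b s. b \<in> B \<Longrightarrow> s \<in> A \<Longrightarrow> b \<otimes> s \<in> T"
    and e: "e \<in> span_prod R A B"
  shows "\<exists>F. finite F \<and> F \<subseteq> A \<and> (\<forall>s\<in>A. e \<otimes> s \<in> span_prod R F T)"
  using e unfolding span_prod_def[of R A B]
proof (induction rule: add_span_induct)
  case zero
  have "\<zero> \<otimes> s \<in> span_prod R {} T" if "s \<in> A" for s
    using that A by (auto simp: span_prod_def add_span_zero)
  then show ?case by blast
next
  case (incl h)
  then obtain a b where ab: "a \<in> A" "b \<in> B" "h = a \<otimes> b" by blast
  have "h \<otimes> s \<in> span_prod R {a} T" if s: "s \<in> A" for s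
  proof -
    have "h \<otimes> s = a \<otimes> (b \<otimes> s)" using ab s A B by (simp add: m_assoc subsetD)
    then show ?thesis using span_prod_incl[of a "{a}" "b \<otimes> s" T] BA ab s by simp
  qed
  then show ?case using ab by (intro exI[of _ "{a}"]) simp
next
  case (uminus h)
  then obtain a b where ab: "a \<in> A" "b \<in> B" "h = a \<otimes> b" by blast
  have "\<ominus> h \<otimes> s \<in> span_prod R {a} T" if s: "s \<in> A" for s
  proof -
    \<comment> \<open>The sign goes into the coefficient: \<open>T\<close> is a subgroup, while
      \<open>A\<close> is any subset.\<close>
    have "\<ominus> h \<otimes> s = a \<otimes> (\<ominus> (b \<otimes> s))" using ab s A B by (simp add: m_assoc subsetD l_minus r_minus)
    then show ?thesis
      using span_prod_incl[of a "{a}" "\<ominus> (b \<otimes> s)" T] additive_subgroup.a_inv_closed[OF T] BA ab s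
      by simp
  qed
  then show ?case using ab by (intro exI[of _ "{a}"]) simp
next
  case (add x y)
  then obtain F F' where F: "finite F" "F \<subseteq> A" "\<forall>s\<in>A. x \<otimes> s \<in> span_prod R F T"
    and F': "finite F'" "F' \<subseteq> A" "\<forall>s\<in>A. y \<otimes> s \<in> span_prod R F' T" by blast
  interpret P: additive_subgroup "span_prod R (F \<union> F') T" R
    using F F' A additive_subgroup.a_subset[OF T] by (intro span_prod_subgroup) auto
  have xy: "x \<in> carrier R" "y \<in> carrier R"
    using add.hyps add_span_carrier[OF span_prod_gens_carrier[OF A B]] by auto
  have "(x \<oplus> y) \<otimes> s \<in> span_prod R (F \<union> F') T" if s: "s \<in> A" for s
  proof -
    have "x \<otimes> s \<in> span_prod R (F \<union> F') T" "y \<otimes> s \<in> span_prod R (F \<union> F') T"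
      using F(3) F'(3) s span_prod_mono[of F "F \<union> F'" T T] span_prod_mono[of F' "F \<union> F'" T T] by auto
    then show ?thesis using s A xy by (simp add: l_distr subsetD)
  qed
  then show ?case using F F' by (intro exI[of _ "F \<union> F'"]) simp
qed

end

section \<open>Cyclic quotients\<close>

text \<open>Models the sums over the cosets \<open>H k^n\<close>. The integers merely label the
  components, which may repeat, as they do when the quotient is finite cyclic.\<close>

locale int_component_family = ring S for S :: "('a, 'b) ring_scheme" (structure) +
  fixes T :: "int \<Rightarrow> 'a set"
  assumes T_subgroup: "additive_subgroup (T i) S"
    and T_mult: "x \<in> T i \<Longrightarrow> y \<in> T j \<Longrightarrow> x \<otimes> y \<in> T (i + j)"
    and T_one: "\<one> \<in> T 0"
    and T_right_unit: "\<exists>e\<in>span_prod S (T (- i)) (T i). \<forall>x\<in>T i. x \<otimes> e = x"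
begin

text \<open>Components may overlap, so an element can lie in several windows and has no canonical
  support. An empty range of degrees gives the zero group.\<close>

definition window :: "int \<Rightarrow> int \<Rightarrow> 'a set" where
  "window a b = add_span S (\<Union>i\<in>{a..b}. T i)"

lemma T_carrier: "T i \<subseteq> carrier S"
  by (rule additive_subgroup.a_subset[OF T_subgroup])

lemma UN_T_carrier: "(\<Union>i\<in>A. T i) \<subseteq> carrier S"
  using T_carrier by blast

lemma window_subgroup: "additive_subgroup (window a b) S"
  unfolding window_def by (rule add_span_subgroup[OF UN_T_carrier])

lemma window_carrier: "x \<in> window a b \<Longrightarrow> x \<in> carrier S"
  using additive_subgroup.a_subset[OF window_subgroup] by blast

lemma window_mono: "a' \<le> a \<Longrightarrow> b \<le> b' \<Longrightarrow> window a b \<subseteq> window a' b'"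
  unfolding window_def by (rule add_span_mono) fastforce

lemma window_mult:
  assumes "x \<in> window a b" "y \<in> T c"
  shows "x \<otimes> y \<in> window (a + c) (b + c)"
proof (rule add_span_mult[OF UN_T_carrier T_carrier window_subgroup])
  show "x \<in> add_span S (\<Union>i\<in>{a..b}. T i)" using assms by (simp add: window_def)
  show "y \<in> add_span S (T c)" using assms by (simp add: add_span_incl)
  fix u v assume "u \<in> (\<Union>i\<in>{a..b}. T i)" "v \<in> T c"
  then obtain i where "i \<in> {a..b}" "u \<in> T i" by blast
  then show "u \<otimes> v \<in> window (a + c) (b + c)"
    unfolding window_def using T_mult[OF \<open>u \<in> T i\<close> \<open>v \<in> T c\<close>]
    by (intro add_span_incl) (auto intro!: bexI[of _ "i + c"])
qed

lemma window_decomp: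
  assumes "x \<in> window a b" "a \<le> b"
  shows "\<exists>y\<in>window a (b - 1). \<exists>z\<in>T b. x = y \<oplus> z"
proof -
  have "(\<Union>i\<in>{a..b}. T i) = (\<Union>i\<in>{a..b - 1}. T i) \<union> T b"
  proof -
    have "{a..b} = insert b {a..b - 1}" using assms(2) by auto
    then show ?thesis by auto
  qed
  then show ?thesis
    using add_span_Un_decomp[OF UN_T_carrier T_subgroup, of x "{a..b - 1}" b] assms(1)
    by (simp add: window_def)
qed

lemma window_empty: "b < a \<Longrightarrow> window a b = {\<zero>}"
  using add_span_least[of "{\<zero>}" "{}"] add_span_zero[of "{}"] additive_subgroupI[of "{\<zero>}" S]
    add.triv_subgroup
  by (auto simp: window_def)

lemma span_T_window:
  assumes "x \<in> add_span S (\<Union>i. T i)"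
  shows "\<exists>a b. x \<in> window a b"
  using assms
proof (induction rule: add_span_induct)
  case zero
  then show ?case using window_empty[of 0 1] by auto
next
  case (incl h)
  then obtain i where "h \<in> T i" by blast
  then have "h \<in> window i i" by (simp add: window_def add_span_incl)
  then show ?case by blast
next
  case (uminus h)
  then obtain i where "h \<in> T i" by blast
  then have "h \<in> window i i" by (simp add: window_def add_span_incl)
  then show ?case using additive_subgroup.a_inv_closed[OF window_subgroup] by blast
next
  case (add x y)
  then obtain a b c d where "x \<in> window a b" "y \<in> window c d" by blast
  then have "x \<in> window (min a c) (max b d)" "y \<in> window (min a c) (max b d)"
    using window_mono[of "min a c" a b "max b d"] window_mono[of "min a c" c d "max b d"] by auto
  then show ?case using additive_subgroup.a_closed[OF window_subgroup] by blast
qed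

text \<open>The ideal \<open>L_l\<close> of the overview. The bound \<open>l\<close> controls the
  lower end of the support when two elements with equal top term are subtracted. For
  \<open>l = 0\<close> the window is zero and \<open>lead I 0\<close> is the intersection of
  \<open>I\<close> with \<open>T 0\<close>.\<close>

definition lead :: "'a set \<Rightarrow> nat \<Rightarrow> 'a set" where
  "lead I l = {t \<in> T 0. \<exists>y\<in>window (- int l) (- 1). t \<oplus> y \<in> I}"

lemma lead_mono: "I \<subseteq> I' \<Longrightarrow> l \<le> l' \<Longrightarrow> lead I l \<subseteq> lead I' l'"
  unfolding lead_def using window_mono[of "- int l'" "- int l" "-1" "-1"] by fastforce

lemma lead_right_ideal:
  assumes I: "additive_subgroup I S" and Ir: "\<And>x r. x \<in> I \<Longrightarrow> r \<in> T 0 \<Longrightarrow> x \<otimes> r \<in> I"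
  shows "right_ideal_in S (T 0) (lead I l)"
proof -
  let ?V = "window (- int l) (- 1)"
  interpret I: additive_subgroup I S by fact
  interpret V: additive_subgroup ?V S by (rule window_subgroup)
  interpret T: additive_subgroup "T 0" S by (rule T_subgroup)
  have "additive_subgroup (lead I l) S"
  proof (intro additive_subgroupI add.subgroupI)
    show "lead I l \<subseteq> carrier S" using T.a_subset by (auto simp: lead_def)
    have "\<zero> \<in> lead I l" by (auto simp: lead_def intro!: bexI[of _ \<zero>])
    then show "lead I l \<noteq> {}" by blast
  next
    fix x assume "x \<in> lead I l"
    then obtain m where x: "x \<in> T 0" "m \<in> ?V" "x \<oplus> m \<in> I" by (auto simp: lead_def)
    then have "\<ominus> (x \<oplus> m) \<in> I" by blast
    moreover have "\<ominus> (x \<oplus> m) = \<ominus> x \<oplus> \<ominus> m"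
      using x by (simp add: minus_add)
    ultimately show "\<ominus> x \<in> lead I l" using x by (auto simp: lead_def intro!: bexI[of _ "\<ominus> m"])
  next
    fix x y assume "x \<in> lead I l" "y \<in> lead I l"
    then obtain m m' where x: "x \<in> T 0" "m \<in> ?V" "x \<oplus> m \<in> I"
      and y: "y \<in> T 0" "m' \<in> ?V" "y \<oplus> m' \<in> I" by (auto simp: lead_def)
    then have "(x \<oplus> m) \<oplus> (y \<oplus> m') \<in> I" by blast
    moreover have "(x \<oplus> m) \<oplus> (y \<oplus> m') = (x \<oplus> y) \<oplus> (m \<oplus> m')"
      using x y by (simp add: a_ac)
    ultimately show "x \<oplus> y \<in> lead I l" using x y by (auto simp: lead_def intro!: bexI[of _ "m \<oplus> m'"])
  qed
  moreover have "x \<otimes> r \<in> lead I l" if xr: "x \<in> lead I l" "r \<in> T 0" for x r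
  proof -
    obtain m where x: "x \<in> T 0" "m \<in> ?V" "x \<oplus> m \<in> I" using xr by (auto simp: lead_def)
    then have "(x \<oplus> m) \<otimes> r \<in> I" "m \<otimes> r \<in> ?V" "x \<otimes> r \<in> T 0"
      using Ir[of "x \<oplus> m" r] window_mult[of m "- int l" "-1" r 0] T_mult[of x 0 r 0] xr by auto
    moreover have "(x \<oplus> m) \<otimes> r = x \<otimes> r \<oplus> m \<otimes> r"
      using x xr by (simp add: l_distr)
    ultimately show ?thesis by (auto simp: lead_def intro!: bexI[of _ "m \<otimes> r"])
  qed
  ultimately show ?thesis
    by (auto simp: right_ideal_in_def additive_subgroup_def lead_def)
qed

text \<open>Induction on a strict bound \<open>n\<close> for \<open>b - a\<close>, so that
  \<open>n = 0\<close> means an empty window. In the step \<open>x\<close> is split as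
  \<open>x e + x (1 - e)\<close>, with \<open>e\<close> the right unit of
  \<open>T b\<close>.\<close>

lemma lead_determines:
  assumes I: "additive_subgroup I S" and I': "additive_subgroup I' S" and II': "I \<subseteq> I'"
    and Ir: "\<And>x i r. x \<in> I \<Longrightarrow> r \<in> T i \<Longrightarrow> x \<otimes> r \<in> I"
    and I'r: "\<And>x i r. x \<in> I' \<Longrightarrow> r \<in> T i \<Longrightarrow> x \<otimes> r \<in> I'"
    and lead: "\<And>l. lead I' l = lead I l"
  shows "b - a < int n \<Longrightarrow> x \<in> I' \<Longrightarrow> x \<in> window a b \<Longrightarrow> x \<in> I"
proof (induction n arbitrary: a b x)
  case 0
  then show ?case using window_empty[of b a] additive_subgroup.zero_closed[OF I] by auto
next
  case (Suc n)
  interpret I: additive_subgroup I S by fact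
  interpret I': additive_subgroup I' S by fact
  \<comment> \<open>For top degree \<open>0\<close>, equality of the ideals provides an element of
    \<open>I\<close> with the same term \<open>t\<close> and all other terms in the same window.
    Subtracting it leaves an element of a shorter window, covered by the induction
    hypothesis.\<close>
  have top0: "x \<in> I" if x: "x \<in> I'" "x \<in> window a 0" and a: "a \<le> 0" "- a \<le> int n" for a x
  proof -
    interpret V: additive_subgroup "window a (- 1)" S by (rule window_subgroup)
    interpret T: additive_subgroup "T 0" S by (rule T_subgroup)
    obtain y t where yt: "y \<in> window a (- 1)" "t \<in> T 0" "x = y \<oplus> t"
      using window_decomp[OF x(2) a(1)] by auto
    have "t \<in> lead I' (nat (- a))"
      using yt x a by (auto simp: lead_def a_comm intro!: bexI[of _ y])
    then have "t \<in> lead I (nat (- a))" by (simp add: lead)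
    then obtain y' where y': "y' \<in> window a (- 1)" "t \<oplus> y' \<in> I"
      using a by (auto simp: lead_def)
    have "y \<oplus> \<ominus> y' = x \<oplus> \<ominus> (t \<oplus> y')"
      using yt y' by (simp add: add_diff_add_cancel)
    also have "\<dots> \<in> I'" using x y' II' by blast
    finally have "y \<oplus> \<ominus> y' \<in> I'" .
    moreover have "y \<oplus> \<ominus> y' \<in> window a (- 1)" using yt y' by blast
    ultimately have "y \<oplus> \<ominus> y' \<in> I" using Suc.IH[of "-1" a] a by auto
    then have "(y \<oplus> \<ominus> y') \<oplus> (t \<oplus> y') \<in> I" using y' by blast
    moreover have "(y \<oplus> \<ominus> y') \<oplus> (t \<oplus> y') = x"
      using yt y' by (simp add: diff_add_add_cancel)
    ultimately show ?thesis by simp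
  qed
  show ?case
  proof (cases "a \<le> b")
    case False
    then show ?thesis using Suc.prems window_empty[of b a] by auto
  next
    case True
    obtain e where e: "e \<in> span_prod S (T (- b)) (T b)" "\<And>x. x \<in> T b \<Longrightarrow> x \<otimes> e = x"
      using T_right_unit by blast
    have xc: "x \<in> carrier S" using Suc.prems by auto
    interpret T0: additive_subgroup "T 0" S by (rule T_subgroup)
    have e0: "e \<in> T 0"
      using span_prod_least[OF T_subgroup[of 0], of "T (-b)" "T b"] T_mult[of _ "-b" _ b] e(1) by auto
    have ec: "e \<in> carrier S" using e0 by simp
    have "x \<otimes> e \<in> I"
    proof -
      \<comment> \<open>Multiplying by \<open>u\<close> of degree \<open>- b\<close> moves the top
        degree to \<open>0\<close>, where \<open>top0\<close> applies; multiplying by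
        \<open>v\<close> then stays inside \<open>I\<close>.\<close>
      have *: "x \<otimes> (u \<otimes> v) \<in> I" if uv: "u \<in> T (- b)" "v \<in> T b" for u v
      proof -
        have uvc: "u \<in> carrier S" "v \<in> carrier S" using uv T_carrier by blast+
        have "x \<otimes> u \<in> I"
        proof (rule top0)
          show "x \<otimes> u \<in> I'" using I'r Suc.prems uv by blast
          show "x \<otimes> u \<in> window (a - b) 0" using window_mult[OF Suc.prems(3) uv(1)] by simp
        qed (use True Suc.prems in auto)
        then show ?thesis using Ir[of "x \<otimes> u" v b] uv uvc xc by (simp add: m_assoc)
      qed
      show ?thesis
        by (rule add_span_mult[OF _ span_prod_gens_carrier[OF T_carrier T_carrier] I,
              of "{x}" "- b" b x e])
          (use * xc e(1) in \<open>auto simp: span_prod_def add_span_incl\<close>)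
    qed
    moreover have "x \<otimes> (\<one> \<oplus> \<ominus> e) \<in> I"
    proof (rule Suc.IH[of "b - 1" a])
      \<comment> \<open>\<open>\<one> \<oplus> \<ominus> e\<close> has degree \<open>0\<close>, so
        it keeps \<open>y\<close> in its window, and it annihilates the top term \<open>z\<close>
        because \<open>z \<otimes> e = z\<close>.\<close>
      have f0: "\<one> \<oplus> \<ominus> e \<in> T 0" using T_one e0 by blast
      obtain y z where yz: "y \<in> window a (b - 1)" "z \<in> T b" "x = y \<oplus> z"
        using window_decomp[OF Suc.prems(3) True] by auto
      have yzc: "y \<in> carrier S" "z \<in> carrier S" using yz window_carrier T_carrier by blast+
      have "z \<otimes> (\<one> \<oplus> \<ominus> e) = \<zero>"
        using e(2)[OF yz(2)] yzc ec by (simp add: r_distr r_minus r_neg)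
      then have "x \<otimes> (\<one> \<oplus> \<ominus> e) = y \<otimes> (\<one> \<oplus> \<ominus> e)"
        using yz(3) yzc ec by (simp add: l_distr)
      then show "x \<otimes> (\<one> \<oplus> \<ominus> e) \<in> window a (b - 1)" using window_mult[OF yz(1) f0] by simp
      show "x \<otimes> (\<one> \<oplus> \<ominus> e) \<in> I'" using I'r[OF Suc.prems(2) f0] .
    qed (use Suc.prems in auto)
    ultimately have "x \<otimes> e \<oplus> x \<otimes> (\<one> \<oplus> \<ominus> e) \<in> I" by blast
    moreover have "x \<otimes> e \<oplus> x \<otimes> (\<one> \<oplus> \<ominus> e) = x"
      using xc ec by (simp add: r_distr r_minus a_comm[of x] r_neg2)
    ultimately show ?thesis by simp
  qed
qed

text \<open>The ideals \<open>lead (I k) l\<close> have to stop at an index uniform in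
  \<open>l\<close>, since elements of a later \<open>I n\<close> may have supports of any length.
  The double chain supplies such an index.\<close>

theorem right_noetherian_span:
  assumes noeth: "right_noetherian_on S (T 0)"
  shows "right_noetherian_on S (add_span S (\<Union>i. T i))"
  unfolding right_noetherian_on_def
proof (intro allI impI)
  let ?U = "add_span S (\<Union>i. T i)"
  fix I :: "nat \<Rightarrow> 'a set"
  assume "(\<forall>n. right_ideal_in S ?U (I n)) \<and> (\<forall>n. I n \<subseteq> I (Suc n))"
  then have ideal: "\<And>n. right_ideal_in S ?U (I n)" and step: "\<And>n. I n \<subseteq> I (Suc n)" by auto
  have sub: "additive_subgroup (I n) S" and IU: "I n \<subseteq> ?U" for n
    using ideal[of n] by (auto simp: right_ideal_in_def additive_subgroup_def)
  have Ir: "x \<otimes> r \<in> I n" if "x \<in> I n" "r \<in> T i" for n x i r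
    using ideal[of n] that add_span_incl[of r "\<Union>i. T i"] by (auto simp: right_ideal_in_def)
  have mono: "m \<le> n \<Longrightarrow> I m \<subseteq> I n" for m n by (rule lift_Suc_mono_le[of I, OF step])
  have "\<exists>N. \<forall>l. \<forall>k\<ge>N. lead (I k) l = lead (I N) l"
  proof (rule right_noetherian_double_chain[OF noeth, of "\<lambda>l k. lead (I k) l"])
    show "right_ideal_in S (T 0) (lead (I k) l)" for l k
      using Ir by (intro lead_right_ideal sub)
    show "lead (I k) l \<subseteq> lead (I k') l'" if "l \<le> l'" "k \<le> k'" for l l' k k'
      using that by (intro lead_mono mono)
  qed
  then obtain N where N: "\<And>l k. k \<ge> N \<Longrightarrow> lead (I k) l = lead (I N) l"
    by blast
  have "I n \<subseteq> I N" if n: "n \<ge> N" for n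
  proof
    fix x assume x: "x \<in> I n"
    then obtain a b where "x \<in> window a b" using span_T_window IU by blast
    then show "x \<in> I N"
      \<comment> \<open>The bound on the length is strict, hence \<open>+ 1\<close>; an empty range
        yields \<open>0\<close>.\<close>
      using lead_determines[of "I N" "I n" b a "nat (b - a + 1)" x] sub mono[OF n] Ir N[OF n] x
      by force
  qed
  then show "\<exists>N. \<forall>n\<ge>N. I n = I N" using mono by blast
qed

end

section \<open>Graded rings with local units\<close>

text \<open>The consequences of an epsilon-strong grading on which the argument rests. As units act
  from the left on one component and from the right on the inverse one, the list is stable under
  passing to the opposite ring with inverted degrees.\<close>

locale local_unit_graded = ring S + grp: group G
  for G :: "('g, 'c) monoid_scheme" and S :: "('a, 'b) ring_scheme" (structure) +
  fixes Sg :: "'g \<Rightarrow> 'a set"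
  assumes Sg_subgroup: "g \<in> carrier G \<Longrightarrow> additive_subgroup (Sg g) S"
    and Sg_mult: "g \<in> carrier G \<Longrightarrow> h \<in> carrier G \<Longrightarrow> x \<in> Sg g \<Longrightarrow> y \<in> Sg h \<Longrightarrow>
      x \<otimes> y \<in> Sg (g \<otimes>\<^bsub>G\<^esub> h)"
    and Sg_one: "\<one> \<in> Sg \<one>\<^bsub>G\<^esub>"
    and Sg_span: "carrier S = add_span S (\<Union>g\<in>carrier G. Sg g)"
    and Sg_unit: "g \<in> carrier G \<Longrightarrow> \<exists>e\<in>span_prod S (Sg g) (Sg (inv\<^bsub>G\<^esub> g)).
      (\<forall>s\<in>Sg g. e \<otimes> s = s) \<and> (\<forall>s\<in>Sg (inv\<^bsub>G\<^esub> g). s \<otimes> e = s)"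
begin

section \<open>Sums of components over sets of degrees\<close>

definition graded_part :: "'g set \<Rightarrow> 'a set" where
  "graded_part A = add_span S (\<Union>g\<in>A. Sg g)"

lemma Sg_carrier: "g \<in> carrier G \<Longrightarrow> Sg g \<subseteq> carrier S"
  by (rule additive_subgroup.a_subset[OF Sg_subgroup])

lemma UN_Sg_carrier: "A \<subseteq> carrier G \<Longrightarrow> (\<Union>g\<in>A. Sg g) \<subseteq> carrier S"
  using Sg_carrier by blast

lemma graded_part_subgroup: "A \<subseteq> carrier G \<Longrightarrow> additive_subgroup (graded_part A) S"
  unfolding graded_part_def by (rule add_span_subgroup[OF UN_Sg_carrier])

lemma graded_part_carrier: "A \<subseteq> carrier G \<Longrightarrow> graded_part A \<subseteq> carrier S"
  by (rule additive_subgroup.a_subset[OF graded_part_subgroup])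

lemma graded_part_mono: "A \<subseteq> B \<Longrightarrow> graded_part A \<subseteq> graded_part B"
  unfolding graded_part_def by (rule add_span_mono) blast

lemma Sg_subset_comp: "g \<in> A \<Longrightarrow> Sg g \<subseteq> graded_part A"
  unfolding graded_part_def by (auto intro: add_span_incl)

lemma graded_part_singleton: "g \<in> carrier G \<Longrightarrow> graded_part {g} = Sg g"
  by (simp add: graded_part_def add_span_of_subgroup Sg_subgroup)

lemma graded_part_mult:
  assumes "A \<subseteq> carrier G" "B \<subseteq> carrier G" "C \<subseteq> carrier G"
    and AB: "\<And>a b. a \<in> A \<Longrightarrow> b \<in> B \<Longrightarrow> a \<otimes>\<^bsub>G\<^esub> b \<in> C"
    and "x \<in> graded_part A" "y \<in> graded_part B"
  shows "x \<otimes> y \<in> graded_part C"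
proof (rule add_span_mult[OF UN_Sg_carrier UN_Sg_carrier graded_part_subgroup])
  fix u v assume "u \<in> (\<Union>g\<in>A. Sg g)" "v \<in> (\<Union>g\<in>B. Sg g)"
  then obtain a b where ab: "a \<in> A" "u \<in> Sg a" "b \<in> B" "v \<in> Sg b" by blast
  then have "u \<otimes> v \<in> Sg (a \<otimes>\<^bsub>G\<^esub> b)" using Sg_mult assms(1,2) by blast
  then show "u \<otimes> v \<in> graded_part C" using Sg_subset_comp[OF AB] ab by blast
qed (use assms in \<open>auto simp: graded_part_def\<close>)

lemma graded_part_left_unit:
  assumes "A \<subseteq> carrier G" "e \<in> carrier S" "\<And>g s. g \<in> A \<Longrightarrow> s \<in> Sg g \<Longrightarrow> e \<otimes> s = s" "s \<in> graded_part A"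
  shows "e \<otimes> s = s"
  using span_left_unit[OF UN_Sg_carrier[OF assms(1)] assms(2) _ assms(4)[unfolded graded_part_def]] assms(3)
  by blast

lemma graded_part_right_unit:
  assumes "A \<subseteq> carrier G" "e \<in> carrier S" "\<And>g s. g \<in> A \<Longrightarrow> s \<in> Sg g \<Longrightarrow> s \<otimes> e = s" "s \<in> graded_part A"
  shows "s \<otimes> e = s"
  using span_right_unit[OF UN_Sg_carrier[OF assms(1)] assms(2) _ assms(4)[unfolded graded_part_def]] assms(3)
  by blast

section \<open>Joining local units\<close>

text \<open>Demanding a unit on both sides makes units for nested sets absorb each other on both sides,
  so that centrality of the local units is never needed.\<close>

definition unit_on :: "'g set \<Rightarrow> 'a \<Rightarrow> bool" where
  "unit_on F e \<longleftrightarrow> e \<in> Sg \<one>\<^bsub>G\<^esub> \<and> e \<in> span_prod S (graded_part F) (graded_part (m_inv G ` F)) \<and>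
     (\<forall>s\<in>graded_part F. e \<otimes> s = s) \<and> (\<forall>s\<in>graded_part (m_inv G ` F). s \<otimes> e = s)"

lemma unit_onI:
  assumes A: "A \<subseteq> carrier G" and e: "e \<in> Sg \<one>\<^bsub>G\<^esub>"
    and "e \<in> span_prod S (graded_part A) (graded_part (m_inv G ` A))"
    and l: "\<And>g s. s \<in> Sg g \<Longrightarrow> g \<in> A \<Longrightarrow> e \<otimes> s = s"
    and r: "\<And>g s. s \<in> Sg g \<Longrightarrow> g \<in> m_inv G ` A \<Longrightarrow> s \<otimes> e = s"
  shows "unit_on A e"
proof -
  have ec: "e \<in> carrier S" using e Sg_carrier[OF grp.one_closed] by blast
  have A': "m_inv G ` A \<subseteq> carrier G" using A by auto
  have "e \<otimes> s = s" if "s \<in> graded_part A" for s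
    by (rule graded_part_left_unit[OF A ec l that])
  moreover have "s \<otimes> e = s" if "s \<in> graded_part (m_inv G ` A)" for s
    by (rule graded_part_right_unit[OF A' ec r that])
  ultimately show ?thesis using assms by (simp add: unit_on_def)
qed

lemma graded_part_mult_principal:
  assumes "A \<subseteq> carrier G" "r \<in> Sg \<one>\<^bsub>G\<^esub>" "s \<in> graded_part A"
  shows "s \<otimes> r \<in> graded_part A" "r \<otimes> s \<in> graded_part A"
proof -
  have r: "r \<in> graded_part {\<one>\<^bsub>G\<^esub>}" using assms(2) by (simp add: graded_part_singleton)
  show "s \<otimes> r \<in> graded_part A"
    by (rule graded_part_mult[OF assms(1) _ assms(1) _ assms(3) r]) (use assms(1) in auto)
  show "r \<otimes> s \<in> graded_part A"
    by (rule graded_part_mult[OF _ assms(1) assms(1) _ r assms(3)]) (use assms(1) in auto)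
qed

lemma unit_on_singleton:
  assumes g: "g \<in> carrier G"
  shows "\<exists>e. unit_on {g} e"
proof -
  obtain e where e: "e \<in> span_prod S (Sg g) (Sg (inv\<^bsub>G\<^esub> g))"
    "\<forall>s\<in>Sg g. e \<otimes> s = s" "\<forall>s\<in>Sg (inv\<^bsub>G\<^esub> g). s \<otimes> e = s"
    using Sg_unit[OF g] by blast
  have "span_prod S (Sg g) (Sg (inv\<^bsub>G\<^esub> g)) \<subseteq> Sg \<one>\<^bsub>G\<^esub>"
    using Sg_mult[of g "inv\<^bsub>G\<^esub> g"] g by (intro span_prod_least Sg_subgroup) auto
  then show ?thesis
    using e g by (auto simp: unit_on_def graded_part_singleton)
qed

text \<open>The new element \<open>u\<close> satisfies \<open>1 - u = (1 - e)(1 - f)\<close>. Acting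
  from the left, \<open>1 - f\<close> annihilates \<open>S_B\<close>; it maps \<open>S_A\<close>
  into itself, as \<open>f\<close> has trivial degree, and there \<open>1 - e\<close> annihilates.
  From the right, on the inverse sets, the factors act in the other order.\<close>

lemma unit_on_Un:
  assumes A: "A \<subseteq> carrier G" and B: "B \<subseteq> carrier G" and e: "unit_on A e" and f: "unit_on B f"
  shows "unit_on (A \<union> B) (e \<oplus> f \<oplus> \<ominus> (e \<otimes> f))"
proof -
  let ?u = "e \<oplus> f \<oplus> \<ominus> (e \<otimes> f)" and ?A' = "m_inv G ` A" and ?B' = "m_inv G ` B"
  let ?P = "span_prod S (graded_part (A \<union> B)) (graded_part (m_inv G ` (A \<union> B)))"
  have AB: "A \<union> B \<subseteq> carrier G" "m_inv G ` (A \<union> B) \<subseteq> carrier G"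
    and A': "?A' \<subseteq> carrier G" and B': "?B' \<subseteq> carrier G" using A B by auto
  have eR: "e \<in> Sg \<one>\<^bsub>G\<^esub>" and fR: "f \<in> Sg \<one>\<^bsub>G\<^esub>" using e f by (auto simp: unit_on_def)
  then have ec: "e \<in> carrier S" and fc: "f \<in> carrier S" using Sg_carrier by blast+
  interpret R: additive_subgroup "Sg \<one>\<^bsub>G\<^esub>" S by (rule Sg_subgroup) simp
  interpret P: additive_subgroup ?P S
    by (rule span_prod_subgroup[OF graded_part_carrier graded_part_carrier]) (use AB in auto)
  have "e \<otimes> f \<in> Sg \<one>\<^bsub>G\<^esub>" using Sg_mult[OF _ _ eR fR] by simp
  then have uR: "?u \<in> Sg \<one>\<^bsub>G\<^esub>" using eR fR by blast
  have "e \<in> ?P"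
    using e span_prod_mono[OF graded_part_mono graded_part_mono, of A "A \<union> B" ?A' "m_inv G ` (A \<union> B)"]
    by (auto simp: unit_on_def)
  moreover have "f \<in> ?P"
    using f span_prod_mono[OF graded_part_mono graded_part_mono, of B "A \<union> B" ?B' "m_inv G ` (A \<union> B)"]
    by (auto simp: unit_on_def)
  moreover have "e \<otimes> f \<in> ?P"
    using span_prod_mult_right[OF graded_part_carrier graded_part_carrier fc _ \<open>e \<in> ?P\<close>] AB
      graded_part_mult_principal[OF _ fR] by blast
  ultimately have "?u \<in> ?P" by blast
  moreover have "?u \<otimes> s = s" if s: "s \<in> Sg g" "g \<in> A \<union> B" for g s
  proof -
    have sc: "s \<in> carrier S" using s AB Sg_carrier by blast
    have us: "?u \<otimes> s = e \<otimes> s \<oplus> f \<otimes> s \<oplus> \<ominus> (e \<otimes> (f \<otimes> s))"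
      using ec fc sc by (simp add: l_distr l_minus m_assoc)
    show ?thesis
    proof (cases "g \<in> A")
      case True
      then have "s \<in> graded_part A" using s Sg_subset_comp by blast
      then have "e \<otimes> s = s" "e \<otimes> (f \<otimes> s) = f \<otimes> s"
        using e graded_part_mult_principal[OF A fR] by (auto simp: unit_on_def)
      then show ?thesis unfolding us using sc fc by (simp add: a_assoc r_neg)
    next
      case False
      then have "s \<in> graded_part B" using s Sg_subset_comp by blast
      then have "f \<otimes> s = s" using f by (auto simp: unit_on_def)
      then show ?thesis unfolding us using sc ec by (simp add: a_comm[of "e \<otimes> s"] a_assoc r_neg)
    qed
  qed
  moreover have "s \<otimes> ?u = s" if s: "s \<in> Sg g" "g \<in> m_inv G ` (A \<union> B)" for g s
  proof -
    have sc: "s \<in> carrier S" using s AB(2) Sg_carrier by blast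
    have us: "s \<otimes> ?u = s \<otimes> e \<oplus> s \<otimes> f \<oplus> \<ominus> (s \<otimes> e \<otimes> f)"
      using ec fc sc by (simp add: r_distr r_minus m_assoc)
    show ?thesis
    proof (cases "g \<in> ?A'")
      case True
      then have "s \<in> graded_part ?A'" using s Sg_subset_comp by blast
      then have "s \<otimes> e = s" using e by (auto simp: unit_on_def)
      then show ?thesis unfolding us using sc fc by (simp add: a_assoc r_neg)
    next
      case False
      then have "s \<in> graded_part ?B'" using s Sg_subset_comp by blast
      then have "s \<otimes> f = s" "s \<otimes> e \<otimes> f = s \<otimes> e"
        using f graded_part_mult_principal[OF B' eR] by (auto simp: unit_on_def)
      then show ?thesis unfolding us using sc ec by (simp add: a_comm[of "s \<otimes> e"] a_assoc r_neg)
    qed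
  qed
  ultimately show ?thesis
    by (intro unit_onI AB uR)
qed

text \<open>\<open>e\<close> is a signed sum of products that begin in \<open>S_A\<close> and end in
  the part of the inverse set; \<open>u\<close> fixes the former from the left and the latter from
  the right.\<close>

lemma unit_on_absorb:
  assumes "B \<subseteq> carrier G" "A \<subseteq> B" "unit_on A e" "unit_on B u"
  shows "u \<otimes> e = e" "e \<otimes> u = e"
proof -
  have sub: "graded_part A \<subseteq> graded_part B" "graded_part (m_inv G ` A) \<subseteq> graded_part (m_inv G ` B)"
    using assms(2) by (simp_all add: graded_part_mono image_mono)
  have c: "graded_part A \<subseteq> carrier S" "graded_part (m_inv G ` A) \<subseteq> carrier S"
    by (rule graded_part_carrier; use assms(1,2) in auto)+
  have uc: "u \<in> carrier S"
    using assms(4) Sg_carrier[OF grp.one_closed] by (auto simp: unit_on_def)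
  have e: "e \<in> span_prod S (graded_part A) (graded_part (m_inv G ` A))"
    using assms(3) by (simp add: unit_on_def)
  show "u \<otimes> e = e"
    by (rule span_prod_left_unit[OF c uc _ e]) (use assms(4) sub in \<open>auto simp: unit_on_def\<close>)
  show "e \<otimes> u = e"
    by (rule span_prod_right_unit[OF c uc _ e]) (use assms(4) sub in \<open>auto simp: unit_on_def\<close>)
qed

lemma principal_right_ideal:
  assumes "e \<in> Sg \<one>\<^bsub>G\<^esub>"
  shows "right_ideal_in S (Sg \<one>\<^bsub>G\<^esub>) {e \<otimes> r | r. r \<in> Sg \<one>\<^bsub>G\<^esub>}"
proof -
  have ec: "e \<in> carrier S" and Rc: "Sg \<one>\<^bsub>G\<^esub> \<subseteq> carrier S"
    using assms Sg_carrier[OF grp.one_closed] by blast+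
  have RR: "x \<otimes> y \<in> Sg \<one>\<^bsub>G\<^esub>" if "x \<in> Sg \<one>\<^bsub>G\<^esub>" "y \<in> Sg \<one>\<^bsub>G\<^esub>" for x y
    using Sg_mult[OF _ _ that] by simp
  have "e \<otimes> r \<otimes> t \<in> {e \<otimes> r | r. r \<in> Sg \<one>\<^bsub>G\<^esub>}" if "r \<in> Sg \<one>\<^bsub>G\<^esub>" "t \<in> Sg \<one>\<^bsub>G\<^esub>" for r t
    using RR[OF that] that ec Rc by (auto simp: m_assoc subsetD)
  then show ?thesis
    using left_translate_subgroup[OF Sg_subgroup[OF grp.one_closed] ec] RR[OF assms]
    by (auto simp: right_ideal_in_def additive_subgroup_def)
qed

text \<open>Among the units of subsets of \<open>C\<close> take \<open>e\<close> with
  \<open>eR\<close> maximal. Adjoining a degree \<open>g\<close> gives \<open>u\<close> with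
  \<open>eR\<close> inside \<open>uR\<close>, so the ideals agree and \<open>u = er\<close>. Then
  \<open>eu = u\<close>, while absorption gives \<open>eu = e\<close>. Thus \<open>e\<close> already
  serves for every degree in \<open>C\<close>.\<close>

lemma ex_unit_on:
  assumes noeth: "right_noetherian_on S (Sg \<one>\<^bsub>G\<^esub>)" and C: "C \<subseteq> carrier G"
  shows "\<exists>e. unit_on C e"
proof -
  let ?R = "Sg \<one>\<^bsub>G\<^esub>"
  let ?I = "\<lambda>e. {e \<otimes> r | r. r \<in> ?R}"
  let ?E = "{e. \<exists>A\<subseteq>C. unit_on A e}"
  have R0: "\<zero> \<in> ?R" using additive_subgroup.zero_closed[OF Sg_subgroup[OF grp.one_closed]] .
  have "graded_part {} = {\<zero>}"
    using add_span_least[of "{\<zero>}" "{}"] add_span_zero[of "{}"] additive_subgroupI[of "{\<zero>}" S]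
      add.triv_subgroup by (auto simp: graded_part_def)
  \<comment> \<open>The empty set, with zero as its unit, makes the family of ideals
    nonempty.\<close>
  then have "unit_on {} \<zero>"
    using R0 by (simp add: unit_on_def span_prod_def add_span_zero)
  then have "?I ` ?E \<noteq> {}" by blast
  moreover have "right_ideal_in S ?R J" if "J \<in> ?I ` ?E" for J
    using that principal_right_ideal by (auto simp: unit_on_def)
  ultimately have "\<exists>M\<in>?I ` ?E. \<forall>J\<in>?I ` ?E. M \<subseteq> J \<longrightarrow> J = M"
    by (rule right_noetherian_maximal[OF noeth])
  then obtain e where "e \<in> ?E" and max: "\<forall>J\<in>?I ` ?E. ?I e \<subseteq> J \<longrightarrow> J = ?I e"
    by (elim bexE imageE) simp
  then obtain A where A: "A \<subseteq> C" and e: "unit_on A e" by blast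
  have eR: "e \<in> ?R" using e by (simp add: unit_on_def)
  have Rc: "?R \<subseteq> carrier S" by (rule Sg_carrier) simp
  have eq: "unit_on (A \<union> {g}) e" if g: "g \<in> C" for g
  proof -
    obtain f where "unit_on {g} f" using unit_on_singleton g C by blast
    then obtain u where u: "unit_on (A \<union> {g}) u"
      using unit_on_Un[OF _ _ e] A C g by blast
    have uR: "u \<in> ?R" using u by (simp add: unit_on_def)
    have ABs: "A \<union> {g} \<subseteq> carrier G" using A C g by blast
    have ue: "u \<otimes> e = e" "e \<otimes> u = e"
      using unit_on_absorb[OF ABs _ e u] by auto
    have sub: "?I e \<subseteq> ?I u"
    proof
      fix x assume "x \<in> ?I e"
      then obtain r where r: "r \<in> ?R" "x = e \<otimes> r" by blast
      then have "x = u \<otimes> (e \<otimes> r)"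
        using ue(1) m_assoc[of u e r] uR eR Rc by auto
      moreover have "e \<otimes> r \<in> ?R" using Sg_mult[OF _ _ eR r(1)] by simp
      ultimately show "x \<in> ?I u" by blast
    qed
    have "u \<in> ?E" using u A g by (intro CollectI exI[of _ "A \<union> {g}"]) simp
    from max[THEN bspec, OF imageI[OF this]] sub have "?I u = ?I e" by (rule mp)
    moreover have "u \<in> ?I u" using uR Rc Sg_one by (auto intro!: exI[of _ \<one>])
    ultimately obtain r where r: "r \<in> ?R" "u = e \<otimes> r" by blast
    \<comment> \<open>\<open>e\<close> absorbs itself, so it fixes every multiple
      \<open>e \<otimes> r\<close>.\<close>
    have "e \<otimes> e = e" using unit_on_absorb[OF _ _ e e] A C by blast
    then have "e \<otimes> u = u"
      using r m_assoc[of e e r] eR Rc by (metis subsetD)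
    then show ?thesis using ue u by simp
  qed
  have "e \<in> span_prod S (graded_part C) (graded_part (m_inv G ` C))"
    using e span_prod_mono[OF graded_part_mono graded_part_mono, of A C "m_inv G ` A" "m_inv G ` C"] A
    by (auto simp: unit_on_def)
  moreover have "e \<otimes> s = s" if "s \<in> Sg g" "g \<in> C" for g s
    using eq[OF that(2)] Sg_subset_comp[of g "A \<union> {g}"] that by (auto simp: unit_on_def)
  moreover have "s \<otimes> e = s" if sg: "s \<in> Sg g" "g \<in> m_inv G ` C" for g s
  proof -
    obtain c where c: "c \<in> C" "g = inv\<^bsub>G\<^esub> c" using sg by blast
    then show ?thesis
      using eq[OF c(1)] Sg_subset_comp[of g "m_inv G ` (A \<union> {c})"] sg by (auto simp: unit_on_def)
  qed
  ultimately have "unit_on C e"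
    by (intro unit_onI C eR)
  then show ?thesis by blast
qed

text \<open>A unit for a coset \<open>C\<close> is a signed sum of products from \<open>C\<close>
  and its inverse set, and the inverse set multiplies \<open>C\<close> into \<open>H\<close>. So
  each coset sum is finitely generated over the part of \<open>H\<close>, and finitely many cosets
  exhaust the ring.\<close>

lemma right_noetherian_finite_index:
  assumes noethR: "right_noetherian_on S (Sg \<one>\<^bsub>G\<^esub>)"
    and H: "normal H G" and fin: "finite (carrier (G Mod H))"
    and noeth: "right_noetherian_on S (graded_part H)"
  shows "right_noetherian_on S (carrier S)"
proof -
  interpret H: normal H G by fact
  have Hc: "H \<subseteq> carrier G" by (rule H.subset)
  let ?T = "graded_part H"
  have T: "additive_subgroup ?T S" by (rule graded_part_subgroup[OF Hc])
  have TT: "s \<otimes> t \<in> ?T" if "s \<in> ?T" "t \<in> ?T" for s t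
    by (rule graded_part_mult[OF Hc Hc Hc _ that]) simp
  have "\<exists>F. finite F \<and> F \<subseteq> carrier S \<and> graded_part C \<subseteq> span_prod S F ?T" if C: "C \<in> carrier (G Mod H)" for C
  proof -
    obtain g where g: "g \<in> carrier G" "C = H #>\<^bsub>G\<^esub> g" using C by (auto simp: carrier_FactGroup)
    have Cc: "C \<subseteq> carrier G" using g Hc by (simp add: grp.r_coset_subset_G)
    have C'c: "m_inv G ` C \<subseteq> carrier G" using Cc by auto
    obtain e where e: "unit_on C e" using ex_unit_on[OF noethR Cc] by blast
    have CC: "b \<otimes>\<^bsub>G\<^esub> c \<in> H" if bc: "b \<in> m_inv G ` C" "c \<in> C" for b c
    proof -
      obtain h h' where h: "h \<in> H" "h' \<in> H" "b = inv\<^bsub>G\<^esub> (h \<otimes>\<^bsub>G\<^esub> g)" "c = h' \<otimes>\<^bsub>G\<^esub> g"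
        using bc g by (auto simp: r_coset_def)
      have hc: "h \<in> carrier G" "h' \<in> carrier G" using h Hc by auto
      \<comment> \<open>For right cosets this product is a conjugate of an element of
        \<open>H\<close>; normality brings it back into \<open>H\<close>.\<close>
      have "b \<otimes>\<^bsub>G\<^esub> c = inv\<^bsub>G\<^esub> g \<otimes>\<^bsub>G\<^esub> (inv\<^bsub>G\<^esub> h \<otimes>\<^bsub>G\<^esub> h') \<otimes>\<^bsub>G\<^esub> g"
        using h hc g by (simp add: grp.inv_mult_group grp.m_assoc)
      also have "\<dots> \<in> H" using h g by (intro H.inv_op_closed1) auto
      finally show ?thesis .
    qed
    have "\<exists>F. finite F \<and> F \<subseteq> graded_part C \<and> (\<forall>s\<in>graded_part C. e \<otimes> s \<in> span_prod S F ?T)"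
    proof (rule span_prod_finite_left[OF graded_part_carrier[OF Cc] graded_part_carrier[OF C'c] T])
      show "b \<otimes> s \<in> ?T" if "b \<in> graded_part (m_inv G ` C)" "s \<in> graded_part C" for b s
        by (rule graded_part_mult[OF C'c Cc Hc CC that])
    qed (use e in \<open>simp add: unit_on_def\<close>)
    moreover have "e \<otimes> s = s" if "s \<in> graded_part C" for s using e that by (simp add: unit_on_def)
    ultimately obtain F where "finite F" "F \<subseteq> graded_part C" "\<forall>s\<in>graded_part C. s \<in> span_prod S F ?T"
      by auto
    then show ?thesis using graded_part_carrier[OF Cc] by blast
  qed
  then obtain F where F: "\<And>C. C \<in> carrier (G Mod H) \<Longrightarrow>
      finite (F C) \<and> F C \<subseteq> carrier S \<and> graded_part C \<subseteq> span_prod S (F C) ?T"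
    by metis
  define F' where "F' = (\<Union>C\<in>carrier (G Mod H). F C)"
  have F'fin: "finite F'" and F'c: "F' \<subseteq> carrier S"
    using F fin by (auto simp: F'_def)
  have "carrier S \<subseteq> span_prod S F' ?T"
    unfolding Sg_span
  proof (rule add_span_least[OF span_prod_subgroup[OF F'c graded_part_carrier[OF Hc]]], safe)
    fix g s assume g: "g \<in> carrier G" and s: "s \<in> Sg g"
    have C: "H #>\<^bsub>G\<^esub> g \<in> carrier (G Mod H)" using g by (auto simp: carrier_FactGroup)
    have "g \<in> H #>\<^bsub>G\<^esub> g" by (rule grp.rcos_self[OF g H.subgroup_axioms])
    then have "s \<in> span_prod S (F (H #>\<^bsub>G\<^esub> g)) ?T"
      using s F[OF C] Sg_subset_comp[of g "H #>\<^bsub>G\<^esub> g"] by blast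
    then show "s \<in> span_prod S F' ?T"
      using span_prod_mono[of "F (H #>\<^bsub>G\<^esub> g)" F' ?T ?T] C by (auto simp: F'_def)
  qed
  note gen = this
  show ?thesis
    unfolding right_noetherian_on_def
  proof (intro allI impI)
    fix I :: "nat \<Rightarrow> 'a set"
    assume I: "(\<forall>n. right_ideal_in S (carrier S) (I n)) \<and> (\<forall>n. I n \<subseteq> I (Suc n))"
    show "\<exists>N. \<forall>n\<ge>N. I n = I N"
    proof (rule finitely_generated_chain_stabilizes[OF T TT noeth F'fin F'c])
      fix n
      have id: "right_ideal_in S (carrier S) (I n)" using I by blast
      then show "right_submodule ?T (I n)"
        using graded_part_carrier[OF Hc]
        by (auto simp: right_ideal_in_def right_submodule_def additive_subgroup_def)
      show "I n \<subseteq> span_prod S F' ?T" using id gen by (auto simp: right_ideal_in_def)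
      show "I n \<subseteq> I (Suc n)" using I by blast
    qed
  qed
qed

text \<open>For a lift \<open>k\<close> of a generator of the quotient, \<open>K\<close> is the
  union of the cosets \<open>H k^n\<close>. Their graded parts form an
  \<open>int_component_family\<close> with the part of \<open>H\<close> in degree \<open>0\<close>;
  the units come from \<open>ex_unit_on\<close>.\<close>

lemma right_noetherian_cyclic_extension:
  assumes noethR: "right_noetherian_on S (Sg \<one>\<^bsub>G\<^esub>)"
    and K: "subgroup K G" and H: "normal H (G\<lparr>carrier := K\<rparr>)"
    and cyc: "cyclic_group ((G\<lparr>carrier := K\<rparr>) Mod H)"
    and noeth: "right_noetherian_on S (graded_part H)"
  shows "right_noetherian_on S (graded_part K)"
proof -
  let ?K = "G\<lparr>carrier := K\<rparr>"
  interpret K: subgroup K G by fact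
  interpret KG: group ?K by (rule grp.subgroup_imp_group[OF K])
  interpret H: normal H ?K by fact
  have HK: "H \<subseteq> K" using H.subset by simp
  have Hc: "H \<subseteq> carrier G" using HK K.subset by blast
  have HG: "subgroup H G" using grp.incl_subgroup[OF K H.subgroup_axioms] .
  interpret HG: subgroup H G by (rule HG)
  have conj: "x \<otimes>\<^bsub>G\<^esub> h \<otimes>\<^bsub>G\<^esub> inv\<^bsub>G\<^esub> x \<in> H" if "x \<in> K" "h \<in> H" for x h
    using H.inv_op_closed2[of x h] that grp.m_inv_consistent[OF K] by simp
  have coset: "r_coset ?K H x = H #>\<^bsub>G\<^esub> x" for x by (simp add: r_coset_def)
  interpret Q: group "?K Mod H" by (rule H.factorgroup_is_group)
  obtain Y where Y: "Y \<in> carrier (?K Mod H)"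
    and Yall: "carrier (?K Mod H) = range (\<lambda>n::int. Y [^]\<^bsub>?K Mod H\<^esub> n)"
    using cyc Q.cyclic_group by blast
  obtain k where k: "k \<in> K" and Yk: "Y = H #>\<^bsub>G\<^esub> k"
    using Y by (auto simp: carrier_FactGroup coset)
  have kc: "k \<in> carrier G" using k K.subset by blast
  define p where "p n = k [^]\<^bsub>G\<^esub> (n::int)" for n
  have pK: "p n \<in> K" for n
    unfolding p_def using grp.subgroup_int_pow_closed[OF K k] .
  have pc: "p n \<in> carrier G" for n using pK K.subset by blast
  have padd: "p (i + j) = p i \<otimes>\<^bsub>G\<^esub> p j" for i j
    unfolding p_def by (rule grp.int_pow_mult[OF kc])
  have pinv: "inv\<^bsub>G\<^esub> (p i) = p (- i)" for i
    unfolding p_def using grp.int_pow_neg[OF kc] by simp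
  have pp: "p i \<otimes>\<^bsub>G\<^esub> p (- i) = \<one>\<^bsub>G\<^esub>" for i
    using pc by (simp flip: pinv)
  \<comment> \<open>The projection is a homomorphism, so powers in the quotient are cosets of powers
    of \<open>k\<close>.\<close>
  have Ypow: "Y [^]\<^bsub>?K Mod H\<^esub> n = H #>\<^bsub>G\<^esub> p n" for n :: int
  proof -
    have "r_coset ?K H (k [^]\<^bsub>?K\<^esub> n) = r_coset ?K H k [^]\<^bsub>?K Mod H\<^esub> n"
      by (rule hom_int_pow[OF H.r_coset_hom_Mod _ KG.group_axioms Q.group_axioms]) (use k in simp)
    then show ?thesis
      using grp.int_pow_consistent[OF K k, of n] by (simp add: coset Yk p_def)
  qed
  define c where "c n = H #>\<^bsub>G\<^esub> p n" for n
  have cc: "c n \<subseteq> carrier G" for n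
    unfolding c_def by (rule grp.r_coset_subset_G[OF Hc pc])
  have cI: "h \<in> H \<Longrightarrow> h \<otimes>\<^bsub>G\<^esub> p n \<in> c n" for h n by (auto simp: c_def r_coset_def)
  have cE: "\<exists>h\<in>H. x = h \<otimes>\<^bsub>G\<^esub> p n" if "x \<in> c n" for x n
    using that by (auto simp: c_def r_coset_def)
  have cK: "(\<Union>n. c n) = K"
  proof
    show "(\<Union>n. c n) \<subseteq> K" using cE HK pK K.m_closed by blast
    show "K \<subseteq> (\<Union>n. c n)"
    proof
      fix x assume x: "x \<in> K"
      then have "H #>\<^bsub>G\<^esub> x \<in> carrier (?K Mod H)" by (auto simp: carrier_FactGroup coset)
      then obtain n where "H #>\<^bsub>G\<^esub> x = c n" using Yall Ypow by (auto simp: c_def)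
      moreover have "x \<in> H #>\<^bsub>G\<^esub> x" using grp.rcos_self[OF _ HG] x K.subset by blast
      ultimately show "x \<in> (\<Union>n. c n)" by blast
    qed
  qed
  have cmult: "x \<otimes>\<^bsub>G\<^esub> y \<in> c (i + j)" if xy: "x \<in> c i" "y \<in> c j" for x y i j
  proof -
    obtain h h' where h: "h \<in> H" "x = h \<otimes>\<^bsub>G\<^esub> p i" "h' \<in> H" "y = h' \<otimes>\<^bsub>G\<^esub> p j"
      using cE xy by meson
    have hc: "h \<in> carrier G" "h' \<in> carrier G" using h Hc by auto
    \<comment> \<open>Moving \<open>p i\<close> past \<open>h'\<close> replaces \<open>h'\<close> by
      a conjugate, which lies in \<open>H\<close> again.\<close>
    have "x \<otimes>\<^bsub>G\<^esub> y = (h \<otimes>\<^bsub>G\<^esub> (p i \<otimes>\<^bsub>G\<^esub> h' \<otimes>\<^bsub>G\<^esub> inv\<^bsub>G\<^esub> (p i))) \<otimes>\<^bsub>G\<^esub> p (i + j)"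
    proof -
      have "inv\<^bsub>G\<^esub> (p i) \<otimes>\<^bsub>G\<^esub> (p i \<otimes>\<^bsub>G\<^esub> p j) = p j"
        using pc by (simp flip: grp.m_assoc)
      then show ?thesis using h hc pc by (simp add: padd grp.m_assoc)
    qed
    then show ?thesis using cI[of "h \<otimes>\<^bsub>G\<^esub> (p i \<otimes>\<^bsub>G\<^esub> h' \<otimes>\<^bsub>G\<^esub> inv\<^bsub>G\<^esub> (p i))"] conj[OF pK] h by simp
  qed
  have cinv1: "m_inv G ` c i \<subseteq> c (- i)" for i
  proof safe
    fix x assume "x \<in> c i"
    then obtain h where h: "h \<in> H" "x = h \<otimes>\<^bsub>G\<^esub> p i" using cE by meson
    have hc: "h \<in> carrier G" using h Hc by auto
    have "inv\<^bsub>G\<^esub> x = (p (- i) \<otimes>\<^bsub>G\<^esub> inv\<^bsub>G\<^esub> h \<otimes>\<^bsub>G\<^esub> inv\<^bsub>G\<^esub> (p (- i))) \<otimes>\<^bsub>G\<^esub> p (- i)"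
      using h hc pc by (simp add: grp.inv_mult_group grp.m_assoc pinv pp)
    then show "inv\<^bsub>G\<^esub> x \<in> c (- i)" using cI conj[OF pK] h by simp
  qed
  \<comment> \<open>Both inclusions matter for a unit of \<open>c (- i)\<close>: one places it in
    the required product, the other lets it fix all of the part of \<open>c i\<close> from the
    right.\<close>
  have cinv: "m_inv G ` c (- i) = c i" for i
  proof
    show "m_inv G ` c (- i) \<subseteq> c i" using cinv1[of "- i"] by simp
    show "c i \<subseteq> m_inv G ` c (- i)"
    proof
      fix x assume x: "x \<in> c i"
      then have "inv\<^bsub>G\<^esub> x \<in> c (- i)" "x \<in> carrier G" using cinv1[of i] cc by auto
      then show "x \<in> m_inv G ` c (- i)" by (metis grp.inv_inv image_eqI)
    qed
  qed
  have c0: "c 0 = H" by (simp add: c_def p_def grp.coset_mult_one[OF Hc])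
  interpret F: int_component_family S "\<lambda>n. graded_part (c n)"
  proof (intro int_component_family.intro int_component_family_axioms.intro ring_axioms)
    show "additive_subgroup (graded_part (c i)) S" for i by (rule graded_part_subgroup[OF cc])
    show "x \<otimes> y \<in> graded_part (c (i + j))" if "x \<in> graded_part (c i)" "y \<in> graded_part (c j)" for x y i j
      by (rule graded_part_mult[OF cc cc cc cmult that])
    show "\<one> \<in> graded_part (c 0)"
      unfolding c0 using Sg_one Sg_subset_comp[OF HG.one_closed] by blast
    show "\<exists>e\<in>span_prod S (graded_part (c (- i))) (graded_part (c i)). \<forall>x\<in>graded_part (c i). x \<otimes> e = x" for i
      using ex_unit_on[OF noethR cc[of "- i"]] by (auto simp: unit_on_def cinv)
  qed
  have "add_span S (\<Union>n. graded_part (c n)) = graded_part K"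
  proof
    have "graded_part (c n) \<subseteq> graded_part K" for n using cK by (intro graded_part_mono) blast
    then show "add_span S (\<Union>n. graded_part (c n)) \<subseteq> graded_part K"
      by (intro add_span_least graded_part_subgroup K.subset) blast
    show "graded_part K \<subseteq> add_span S (\<Union>n. graded_part (c n))"
      unfolding graded_part_def[of K] using cK Sg_subset_comp by (intro add_span_mono) blast
  qed
  then show ?thesis using F.right_noetherian_span noeth c0 by simp
qed

text \<open>The hypothesis on the principal component is carried along the whole series: it supplies
  the local units at each cyclic step and again at the finite one.\<close>

theorem right_noetherian_polycyclic_by_finite:
  assumes "polycyclic_by_finite G" and noethR: "right_noetherian_on S (Sg \<one>\<^bsub>G\<^esub>)"
  shows "right_noetherian_on S (carrier S)"
proof -
  obtain n H where H0: "H 0 = {\<one>\<^bsub>G\<^esub>}" and Hn: "H (Suc n) = carrier G"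
    and sub: "\<And>i. i \<le> n \<Longrightarrow> subgroup (H (Suc i)) G"
    and nrm: "\<And>i. i \<le> n \<Longrightarrow> normal (H i) (G\<lparr>carrier := H (Suc i)\<rparr>)"
    and fin: "finite (carrier (G Mod (H n)))"
    and cyc: "\<And>i. i < n \<Longrightarrow> cyclic_group ((G\<lparr>carrier := H (Suc i)\<rparr>) Mod (H i))"
    using assms(1) unfolding polycyclic_by_finite_def by blast
  have "right_noetherian_on S (graded_part (H i))" if "i \<le> n" for i
    using that
  proof (induction i)
    case 0
    then show ?case using noethR by (simp add: H0 graded_part_singleton)
  next
    case (Suc i)
    then show ?case
      using right_noetherian_cyclic_extension[OF noethR sub nrm cyc] by simp
  qed
  then have "right_noetherian_on S (graded_part (H n))" by simp
  moreover have "normal (H n) G" using nrm[of n] Hn by simp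
  ultimately show ?thesis using right_noetherian_finite_index[OF noethR _ fin] by blast
qed

end

section \<open>The opposite ring\<close>

text \<open>Only the multiplication changes, so additive spans and subgroups are literally the
  same.\<close>

definition opposite_ring :: "('a, 'b) ring_scheme \<Rightarrow> ('a, 'b) ring_scheme" where
  "opposite_ring S = S\<lparr>mult := \<lambda>x y. y \<otimes>\<^bsub>S\<^esub> x\<rparr>"

lemma opposite_ring_simps [simp]:
  "carrier (opposite_ring S) = carrier S"
  "x \<otimes>\<^bsub>opposite_ring S\<^esub> y = y \<otimes>\<^bsub>S\<^esub> x"
  "\<one>\<^bsub>opposite_ring S\<^esub> = \<one>\<^bsub>S\<^esub>"
  "\<zero>\<^bsub>opposite_ring S\<^esub> = \<zero>\<^bsub>S\<^esub>"
  "add (opposite_ring S) = add S"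
  by (simp_all add: opposite_ring_def)

lemma add_monoid_opposite_ring: "add_monoid (opposite_ring S) = add_monoid S"
  by (simp add: opposite_ring_def)

lemma additive_subgroup_opposite_ring:
  "additive_subgroup A (opposite_ring S) \<longleftrightarrow> additive_subgroup A S"
  unfolding additive_subgroup_def add_monoid_opposite_ring ..

lemma add_span_opposite_ring: "add_span (opposite_ring S) A = add_span S A"
  unfolding add_span_def add_monoid_opposite_ring ..

lemma span_prod_opposite_ring: "span_prod (opposite_ring S) A B = span_prod S B A"
proof -
  have "{a \<otimes>\<^bsub>opposite_ring S\<^esub> b | a b. a \<in> A \<and> b \<in> B} = {a \<otimes>\<^bsub>S\<^esub> b | a b. a \<in> B \<and> b \<in> A}"
    by auto
  then show ?thesis unfolding span_prod_def add_span_opposite_ring by (rule arg_cong)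
qed

lemma right_noetherian_opposite_ring:
  "right_noetherian_on (opposite_ring S) R \<longleftrightarrow> left_noetherian_on S R"
  by (simp add: right_noetherian_on_def left_noetherian_on_def right_ideal_in_def left_ideal_in_def
      add_monoid_opposite_ring)

lemma (in ring) ring_opposite_ring: "ring (opposite_ring R)"
proof (rule ring.intro)
  show "abelian_group (opposite_ring R)"
    using abelian_group_axioms
    unfolding abelian_group_def abelian_monoid_def abelian_group_axioms_def add_monoid_opposite_ring .
  show "monoid (opposite_ring R)"
    by (rule monoidI) (simp_all add: m_assoc)
  show "ring_axioms (opposite_ring R)"
    by (rule ring_axioms.intro) (simp_all add: l_distr r_distr)
qed

text \<open>Inverting degrees matches the reversed order of products. The unit chosen for
  \<open>g\<close> serves again, with its left and right actions exchanged.\<close>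

lemma (in local_unit_graded) local_unit_graded_opposite_ring:
  "local_unit_graded G (opposite_ring S) (\<lambda>g. Sg (inv\<^bsub>G\<^esub> g))"
proof (intro local_unit_graded.intro local_unit_graded_axioms.intro ring_opposite_ring
    grp.group_axioms)
  show "additive_subgroup (Sg (inv\<^bsub>G\<^esub> g)) (opposite_ring S)" if "g \<in> carrier G" for g
    using that by (simp add: additive_subgroup_opposite_ring Sg_subgroup)
  show "x \<otimes>\<^bsub>opposite_ring S\<^esub> y \<in> Sg (inv\<^bsub>G\<^esub> (g \<otimes>\<^bsub>G\<^esub> h))"
    if "g \<in> carrier G" "h \<in> carrier G" "x \<in> Sg (inv\<^bsub>G\<^esub> g)" "y \<in> Sg (inv\<^bsub>G\<^esub> h)" for g h x y
    using Sg_mult[of "inv\<^bsub>G\<^esub> h" "inv\<^bsub>G\<^esub> g" y x] that by (simp add: grp.inv_mult_group)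
  show "\<one>\<^bsub>opposite_ring S\<^esub> \<in> Sg (inv\<^bsub>G\<^esub> \<one>\<^bsub>G\<^esub>)"
    using Sg_one by simp
  have "(\<Union>g\<in>carrier G. Sg (inv\<^bsub>G\<^esub> g)) = (\<Union>g\<in>m_inv G ` carrier G. Sg g)" by simp
  also have "m_inv G ` carrier G = carrier G"
  proof
    show "carrier G \<subseteq> m_inv G ` carrier G"
      by (metis grp.inv_closed grp.inv_inv image_eqI subsetI)
  qed auto
  finally show "carrier (opposite_ring S) = add_span (opposite_ring S) (\<Union>g\<in>carrier G. Sg (inv\<^bsub>G\<^esub> g))"
    using Sg_span by (simp add: add_span_opposite_ring)
  show "\<exists>e\<in>span_prod (opposite_ring S) (Sg (inv\<^bsub>G\<^esub> g)) (Sg (inv\<^bsub>G\<^esub> (inv\<^bsub>G\<^esub> g))).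
      (\<forall>s\<in>Sg (inv\<^bsub>G\<^esub> g). e \<otimes>\<^bsub>opposite_ring S\<^esub> s = s) \<and>
      (\<forall>s\<in>Sg (inv\<^bsub>G\<^esub> (inv\<^bsub>G\<^esub> g)). s \<otimes>\<^bsub>opposite_ring S\<^esub> e = s)" if "g \<in> carrier G" for g
    using Sg_unit[OF that] that by (auto simp: span_prod_opposite_ring)
qed

section \<open>Epsilon-strong gradings\<close>

text \<open>Let \<open>P g\<close> be the product of the components at \<open>g\<close> and at its
  inverse. The component at \<open>g\<close> equals \<open>P g\<close> times itself, so the unit of
  \<open>P g\<close> fixes it from the left; the component at the inverse lies in itself times
  \<open>P g\<close>, so the same unit fixes it from the right.\<close>

lemma epsilon_strongly_graded_local_units:
  fixes G :: "('g, 'c) monoid_scheme" and S :: "('a, 'b) ring_scheme" (structure)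
  assumes "group G" "ring S" and eps: "epsilon_strongly_graded G S Sg"
  shows "local_unit_graded G S Sg"
proof -
  interpret group G by fact
  interpret ring S by fact
  have gr: "graded_ring G S Sg" using eps by (simp add: epsilon_strongly_graded_def)
  have sub: "additive_subgroup (Sg g) S" if "g \<in> carrier G" for g
    using gr that by (simp add: graded_ring_def additive_subgroup_def)
  have car: "Sg g \<subseteq> carrier S" if "g \<in> carrier G" for g
    using additive_subgroup.a_subset[OF sub[OF that]] .
  have mult: "x \<otimes> y \<in> Sg (g \<otimes>\<^bsub>G\<^esub> h)"
    if "g \<in> carrier G" "h \<in> carrier G" "x \<in> Sg g" "y \<in> Sg h" for g h x y
    using gr that by (simp add: graded_ring_def)
  define P where "P g = span_prod S (Sg g) (Sg (inv\<^bsub>G\<^esub> g))" for g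
  have Peq: "ring_set_prod S (Sg g) (Sg (inv\<^bsub>G\<^esub> g)) = P g" if "g \<in> carrier G" for g
    unfolding P_def using that by (intro ring_set_prod_eq_span_prod sub car) auto
  have Psub: "additive_subgroup (P g) S" if "g \<in> carrier G" for g
    unfolding P_def using that by (intro span_prod_subgroup car) auto
  have Pcar: "P g \<subseteq> carrier S" if "g \<in> carrier G" for g
    using additive_subgroup.a_subset[OF Psub[OF that]] .
  have PR: "P g \<subseteq> Sg \<one>\<^bsub>G\<^esub>" if g: "g \<in> carrier G" for g
    unfolding P_def using mult[of g "inv\<^bsub>G\<^esub> g"] g by (intro span_prod_least sub) auto
  have PSg: "span_prod S (P g) (Sg g) = Sg g" if "g \<in> carrier G" for g
    using eps that ring_set_prod_eq_span_prod[OF Psub car, of g g] Peq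
    by (simp add: epsilon_strongly_graded_def)
  have unitP: "\<exists>e\<in>P g. \<forall>x\<in>P g. e \<otimes> x = x \<and> x \<otimes> e = x" if "g \<in> carrier G" for g
    using eps that Peq by (simp add: epsilon_strongly_graded_def)
  have unit: "\<exists>e\<in>P g. (\<forall>s\<in>Sg g. e \<otimes> s = s) \<and> (\<forall>s\<in>Sg (inv\<^bsub>G\<^esub> g). s \<otimes> e = s)"
    if g: "g \<in> carrier G" for g
  proof -
    obtain e where e: "e \<in> P g" "\<forall>x\<in>P g. e \<otimes> x = x \<and> x \<otimes> e = x" using unitP[OF g] by blast
    have ec: "e \<in> carrier S" using e Pcar[OF g] by blast
    have gi: "inv\<^bsub>G\<^esub> g \<in> carrier G" using g by simp
    have "e \<otimes> s = s" if "s \<in> Sg g" for s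
      by (rule span_prod_left_unit[OF Pcar[OF g] car[OF g] ec]) (use e that PSg[OF g] in auto)
    moreover have "s \<otimes> e = s" if s: "s \<in> Sg (inv\<^bsub>G\<^esub> g)" for s
    proof (rule span_prod_right_unit[OF car[OF gi] Pcar[OF g] ec])
      have "s \<in> span_prod S (P (inv\<^bsub>G\<^esub> g)) (Sg (inv\<^bsub>G\<^esub> g))" using s PSg[OF gi] by simp
      then show "s \<in> span_prod S (Sg (inv\<^bsub>G\<^esub> g)) (P g)"
        using span_prod_assoc[OF car[OF gi] car[OF g] car[OF gi]] g by (auto simp: P_def)
    qed (use e in blast)
    ultimately show ?thesis using e by blast
  qed
  have span: "carrier S = add_span S (\<Union>g\<in>carrier G. Sg g)"
  proof
    have UNc: "(\<Union>g\<in>carrier G. Sg g) \<subseteq> carrier S" using car by blast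
    show "add_span S (\<Union>g\<in>carrier G. Sg g) \<subseteq> carrier S"
      using add_span_carrier[OF UNc] by blast
    show "carrier S \<subseteq> add_span S (\<Union>g\<in>carrier G. Sg g)"
    proof
      fix x assume x: "x \<in> carrier S"
      obtain f where f: "\<forall>g\<in>carrier G. f g \<in> Sg g" "\<forall>g. g \<notin> carrier G \<longrightarrow> f g = \<zero>"
        "finite {g. f g \<noteq> \<zero>}" "x = finsum S f {g. f g \<noteq> \<zero>}"
        using gr[unfolded graded_ring_def, THEN conjunct2, THEN conjunct1, THEN bspec, OF x,
            THEN ex1_implies_ex]
        by (elim exE conjE)
      have "f g \<in> add_span S (\<Union>g\<in>carrier G. Sg g)" if "g \<in> {g. f g \<noteq> \<zero>}" for g
      proof -
        have "g \<in> carrier G" using f(2) that by blast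
        then show ?thesis using f(1) by (intro add_span_incl) blast
      qed
      then show "x \<in> add_span S (\<Union>g\<in>carrier G. Sg g)"
        unfolding f(4) by (rule finsum_in_additive_subgroup[OF add_span_subgroup[OF UNc] f(3)])
    qed
  qed
  \<comment> \<open>The unit of the principal component fixes every component, hence it is the unit of the ring.\<close>
  have one: "\<one> \<in> Sg \<one>\<^bsub>G\<^esub>"
  proof -
    obtain e where e: "e \<in> P \<one>\<^bsub>G\<^esub>" "\<forall>s\<in>Sg \<one>\<^bsub>G\<^esub>. e \<otimes> s = s" using unit[of "\<one>\<^bsub>G\<^esub>"] by auto
    have eR: "e \<in> Sg \<one>\<^bsub>G\<^esub>" using e PR[of "\<one>\<^bsub>G\<^esub>"] by auto
    then have ec: "e \<in> carrier S" using car[of "\<one>\<^bsub>G\<^esub>"] by auto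
    have "e \<otimes> s = s" if s: "s \<in> (\<Union>g\<in>carrier G. Sg g)" for s
    proof -
      obtain g where g: "g \<in> carrier G" "s \<in> Sg g" using s by blast
      show ?thesis
        by (rule span_prod_left_unit[OF Pcar[OF g(1)] car[OF g(1)] ec])
          (use e PR[OF g(1)] PSg[OF g(1)] g in auto)
    qed
    then have "e \<otimes> \<one> = \<one>"
      using span_left_unit[of "\<Union>g\<in>carrier G. Sg g" e \<one>] ec span car by blast
    then show ?thesis using eR ec by simp
  qed
  show ?thesis
    by (intro local_unit_graded.intro local_unit_graded_axioms.intro assms(1,2))
      (use sub mult one span unit in \<open>auto simp: P_def\<close>)
qed

theorem theorem3p7:
  fixes G :: "('g, 'c) monoid_scheme" and S :: "('a, 'b) ring_scheme" and Sg :: "'g \<Rightarrow> 'a set"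
  assumes "group G" and "polycyclic_by_finite G"
    and "ring S" and "\<one>\<^bsub>S\<^esub> \<noteq> \<zero>\<^bsub>S\<^esub>"
    and "epsilon_strongly_graded G S Sg"
  shows "(right_noetherian_on S (Sg \<one>\<^bsub>G\<^esub>) \<longrightarrow> right_noetherian_on S (carrier S)) \<and>
         (left_noetherian_on S (Sg \<one>\<^bsub>G\<^esub>) \<longrightarrow> left_noetherian_on S (carrier S))"
proof -
  interpret group G by fact
  interpret L: local_unit_graded G S Sg
    using assms by (intro epsilon_strongly_graded_local_units)
  \<comment> \<open>Its principal component is \<open>Sg\<close> at the inverse of the identity,
    which is the original one.\<close>
  interpret Op: local_unit_graded G "opposite_ring S" "\<lambda>g. Sg (inv\<^bsub>G\<^esub> g)"
    by (rule L.local_unit_graded_opposite_ring)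
  show ?thesis
    using L.right_noetherian_polycyclic_by_finite[OF assms(2)]
      Op.right_noetherian_polycyclic_by_finite[OF assms(2)]
    by (simp add: right_noetherian_opposite_ring)
qed

end
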